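(* Let $\Phi$ be simply-laced with Coxeter number $h$, let $b$ be a positive integer relatively prime to $h$, and let $\widetilde w_b\in\widetilde W$ be the unique element with $\widetilde w_b(\check\rho/h)=b\check\rho/h$. Then \[{\sf inv}(\widetilde w_b)=\left\{-\alpha+k\delta:\alpha\in\Phi^+,\ 0<k<\tfrac{b}{h}\mathrm{ht}(\alpha)\right\}.\]
   Context: $\Phi$ is an irreducible crystallographic root system in a Euclidean space $V$ (highest root $\tilde\alpha$ normalized to $\|\tilde\alpha\|^2=2$; simply-laced: all roots of squared length 2), Weyl group $W$, positive roots $\Phi^+$, simple roots $\alpha_1,\dots,\alpha_n$, height $\mathrm{ht}(\sum a_i\alpha_i)=\sum a_i$, $h=1+\mathrm{ht}(\tilde\alpha)$, $\check\rho=\sum_i\check\omega_i$ with $\langle\check\omega_i,\alpha_j\rangle=\delta_{ij}$. $\widetilde W=W\ltimes\check Q$ is the affine Weyl group ($\check Q$ the coroot lattice, acting by translations $t_\mu$). Affine roots $\alpha+k\delta$ ($\alpha\in\Phi,k\in\mathbb Z$) are acted on by $wt_\mu(\alpha+k\delta)=w(\alpha)+(k-\langle\mu,\alpha\rangle)\delta$; positive affine roots are those with $\alpha\in\Phi^+,k\ge0$ or $\alpha\in-\Phi^+,k>0$; ${\sf inv}(\widetilde u)$ is the set of positive affine roots $\beta$ with $\widetilde u^{-1}(\beta)$ not positive. *)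

theory Defs
  imports "HOL-Analysis.Analysis"
begin

text \<open>
  The ambient Euclidean space is identified with its dual through the inner product, so that
  coroots, coweights and translations are vectors of the same space, and the pairing of a
  coweight with a root is the inner product.
\<close>

definition coroot :: "'a::euclidean_space \<Rightarrow> 'a" where
  "coroot \<alpha> = (2 / (\<alpha> \<bullet> \<alpha>)) *\<^sub>R \<alpha>"

definition root_reflection :: "'a::euclidean_space \<Rightarrow> 'a \<Rightarrow> 'a" where
  "root_reflection \<alpha> x = x - (x \<bullet> coroot \<alpha>) *\<^sub>R \<alpha>"

definition crystallographic_root_system :: "'a::euclidean_space set \<Rightarrow> bool" where
  "crystallographic_root_system \<Phi> \<longleftrightarrow>
     finite \<Phi> \<and> 0 \<notin> \<Phi> \<and> span \<Phi> = UNIV \<and>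
     (\<forall>\<alpha>\<in>\<Phi>. \<forall>c. c *\<^sub>R \<alpha> \<in> \<Phi> \<longleftrightarrow> c = 1 \<or> c = -1) \<and>
     (\<forall>\<alpha>\<in>\<Phi>. root_reflection \<alpha> ` \<Phi> = \<Phi>) \<and>
     (\<forall>\<alpha>\<in>\<Phi>. \<forall>\<beta>\<in>\<Phi>. \<beta> \<bullet> coroot \<alpha> \<in> \<int>)"

definition irreducible_roots :: "'a::euclidean_space set \<Rightarrow> bool" where
  "irreducible_roots \<Phi> \<longleftrightarrow>
     \<Phi> \<noteq> {} \<and>
     \<not> (\<exists>A B. A \<noteq> {} \<and> B \<noteq> {} \<and> A \<inter> B = {} \<and> A \<union> B = \<Phi> \<and> (\<forall>\<alpha>\<in>A. \<forall>\<beta>\<in>B. \<alpha> \<bullet> \<beta> = 0))"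

text \<open>
  The common squared length 2 of the roots subsumes the normalization of the highest root.
\<close>

definition simply_laced :: "'a::euclidean_space set \<Rightarrow> bool" where
  "simply_laced \<Phi> \<longleftrightarrow> (\<forall>\<alpha>\<in>\<Phi>. \<alpha> \<bullet> \<alpha> = 2)"

definition simple_roots :: "'a::euclidean_space set \<Rightarrow> 'a set \<Rightarrow> bool" where
  "simple_roots \<Phi> \<Delta> \<longleftrightarrow>
     \<Delta> \<subseteq> \<Phi> \<and> independent \<Delta> \<and> span \<Delta> = UNIV \<and>
     (\<forall>\<beta>\<in>\<Phi>. (\<forall>\<alpha>\<in>\<Delta>. representation \<Delta> \<beta> \<alpha> \<in> \<int>) \<and>
        ((\<forall>\<alpha>\<in>\<Delta>. 0 \<le> representation \<Delta> \<beta> \<alpha>) \<or> (\<forall>\<alpha>\<in>\<Delta>. representation \<Delta> \<beta> \<alpha> \<le> 0)))"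

definition pos_roots :: "'a::euclidean_space set \<Rightarrow> 'a set \<Rightarrow> 'a set" where
  "pos_roots \<Phi> \<Delta> = {\<beta> \<in> \<Phi>. \<forall>\<alpha>\<in>\<Delta>. 0 \<le> representation \<Delta> \<beta> \<alpha>}"

text \<open>The coefficients of a root are integers, so the floor only changes the type.\<close>

definition ht :: "'a::euclidean_space set \<Rightarrow> 'a \<Rightarrow> int" where
  "ht \<Delta> \<beta> = \<lfloor>\<Sum>\<alpha>\<in>\<Delta>. representation \<Delta> \<beta> \<alpha>\<rfloor>"

definition highest_root :: "'a::euclidean_space set \<Rightarrow> 'a set \<Rightarrow> 'a" where
  "highest_root \<Phi> \<Delta> =
     (THE \<theta>. \<theta> \<in> \<Phi> \<and> (\<forall>\<beta>\<in>\<Phi>. \<forall>\<alpha>\<in>\<Delta>. representation \<Delta> \<beta> \<alpha> \<le> representation \<Delta> \<theta> \<alpha>))"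

definition coxeter_number :: "'a::euclidean_space set \<Rightarrow> 'a set \<Rightarrow> int" where
  "coxeter_number \<Phi> \<Delta> = 1 + ht \<Delta> (highest_root \<Phi> \<Delta>)"

definition fund_coweight :: "'a::euclidean_space set \<Rightarrow> 'a \<Rightarrow> 'a" where
  "fund_coweight \<Delta> \<alpha> = (THE \<omega>. \<forall>\<beta>\<in>\<Delta>. \<omega> \<bullet> \<beta> = (if \<beta> = \<alpha> then 1 else 0))"

definition rho_check :: "'a::euclidean_space set \<Rightarrow> 'a" where
  "rho_check \<Delta> = (\<Sum>\<alpha>\<in>\<Delta>. fund_coweight \<Delta> \<alpha>)"

text \<open>Reflections are involutions, so the monoid they generate is a group.\<close>

inductive_set weyl_group :: "'a::euclidean_space set \<Rightarrow> ('a \<Rightarrow> 'a) set" for \<Phi> where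
  id: "id \<in> weyl_group \<Phi>"
| refl: "\<alpha> \<in> \<Phi> \<Longrightarrow> w \<in> weyl_group \<Phi> \<Longrightarrow> root_reflection \<alpha> \<circ> w \<in> weyl_group \<Phi>"

definition coroot_lattice :: "'a::euclidean_space set \<Rightarrow> 'a set" where
  "coroot_lattice \<Phi> = range (\<lambda>c :: 'a \<Rightarrow> int. \<Sum>\<alpha>\<in>\<Phi>. of_int (c \<alpha>) *\<^sub>R coroot \<alpha>)"

text \<open>The pair \<open>(w, \<mu>)\<close> stands for the element \<open>w t\<^sub>\<mu>\<close>: first translate by \<open>\<mu>\<close>, then apply \<open>w\<close>.\<close>

type_synonym 'a affine_elem = "('a \<Rightarrow> 'a) \<times> 'a"

definition affine_weyl_group :: "'a::euclidean_space set \<Rightarrow> 'a affine_elem set" where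
  "affine_weyl_group \<Phi> = weyl_group \<Phi> \<times> coroot_lattice \<Phi>"

fun aff_act :: "'a::euclidean_space affine_elem \<Rightarrow> 'a \<Rightarrow> 'a" where
  "aff_act (w, \<mu>) x = w (x + \<mu>)"

text \<open>
  The inverse of \<open>w\<close> after translation by \<open>\<mu>\<close> is \<open>inv w\<close> after translation by \<open>- w \<mu>\<close>;
  compare the lemmas \<open>aff_act_inv\<close> and \<open>aff_root_act_inv\<close> below.
\<close>

fun aff_inv :: "'a::euclidean_space affine_elem \<Rightarrow> 'a affine_elem" where
  "aff_inv (w, \<mu>) = (inv w, - w \<mu>)"

text \<open>
  The pair \<open>(\<alpha>, k)\<close> stands for the affine root \<open>\<alpha> + k\<delta>\<close>. The pairing of a coroot lattice
  element with a root is an integer, so the floor only changes the type.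
\<close>

type_synonym 'a affine_root = "'a \<times> int"

fun aff_root_act :: "'a::euclidean_space affine_elem \<Rightarrow> 'a affine_root \<Rightarrow> 'a affine_root" where
  "aff_root_act (w, \<mu>) (\<alpha>, k) = (w \<alpha>, k - \<lfloor>\<mu> \<bullet> \<alpha>\<rfloor>)"

definition pos_affine_roots :: "'a::euclidean_space set \<Rightarrow> 'a set \<Rightarrow> 'a affine_root set" where
  "pos_affine_roots \<Phi> \<Delta> =
     {(\<alpha>, k) | \<alpha> k. \<alpha> \<in> pos_roots \<Phi> \<Delta> \<and> 0 \<le> k} \<union>
     {(- \<alpha>, k) | \<alpha> k. \<alpha> \<in> pos_roots \<Phi> \<Delta> \<and> 0 < k}"

definition inversion_set ::
    "'a::euclidean_space set \<Rightarrow> 'a set \<Rightarrow> 'a affine_elem \<Rightarrow> 'a affine_root set" where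
  "inversion_set \<Phi> \<Delta> u =
     {\<beta> \<in> pos_affine_roots \<Phi> \<Delta>. aff_root_act (aff_inv u) \<beta> \<notin> pos_affine_roots \<Phi> \<Delta>}"

definition sends_rho :: "'a::euclidean_space set \<Rightarrow> 'a set \<Rightarrow> int \<Rightarrow> 'a affine_elem \<Rightarrow> bool" where
  "sends_rho \<Phi> \<Delta> b u \<longleftrightarrow>
     aff_act u ((1 / of_int (coxeter_number \<Phi> \<Delta>)) *\<^sub>R rho_check \<Delta>) =
     (of_int b / of_int (coxeter_number \<Phi> \<Delta>)) *\<^sub>R rho_check \<Delta>"

definition w_elem :: "'a::euclidean_space set \<Rightarrow> 'a set \<Rightarrow> int \<Rightarrow> 'a affine_elem" where
  "w_elem \<Phi> \<Delta> b = (THE u. u \<in> affine_weyl_group \<Phi> \<and> sends_rho \<Phi> \<Delta> b u)"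

lemma root_reflection_involution: "root_reflection \<alpha> (root_reflection \<alpha> x) = x"
  by (cases "\<alpha> = 0") (simp_all add: root_reflection_def coroot_def algebra_simps)

lemma linear_root_reflection: "linear (root_reflection \<alpha>)"
  by (rule linearI) (simp_all add: root_reflection_def algebra_simps)

lemma inner_root_reflection: "root_reflection \<alpha> x \<bullet> root_reflection \<alpha> y = x \<bullet> y"
  by (cases "\<alpha> = 0") (simp_all add: root_reflection_def coroot_def inner_commute algebra_simps)

lemma weyl_group_isometry:
  assumes "w \<in> weyl_group \<Phi>"
  shows "linear w \<and> bij w \<and> (\<forall>x y. w x \<bullet> w y = x \<bullet> y)"
  using assms
proof induction
  case id
  show ?case by (simp add: linear_id[unfolded id_def] id_def bij_id[unfolded id_def])
next
  case (refl \<alpha> w)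
  have "bij (root_reflection \<alpha>)" by (rule o_bij[of "root_reflection \<alpha>"]) (auto simp: root_reflection_involution)
  with refl show ?case
    by (intro conjI linear_compose bij_comp linear_root_reflection) (auto simp: inner_root_reflection)
qed

lemma aff_act_inv:
  assumes "u \<in> affine_weyl_group \<Phi>"
  shows "aff_act (aff_inv u) (aff_act u x) = x"
proof -
  obtain w \<mu> where u: "u = (w, \<mu>)" "w \<in> weyl_group \<Phi>"
    using assms by (auto simp: affine_weyl_group_def)
  note w = weyl_group_isometry[OF u(2)]
  have "w (x + \<mu>) + - w \<mu> = w x" using w by (simp add: linear_add)
  then show ?thesis using w by (simp add: u(1) bij_is_inj)
qed

lemma coroot_lattice_integral:
  assumes "crystallographic_root_system \<Phi>" "\<mu> \<in> coroot_lattice \<Phi>" "\<alpha> \<in> \<Phi>"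
  shows "\<mu> \<bullet> \<alpha> \<in> \<int>"
  using assms
  by (auto simp: coroot_lattice_def crystallographic_root_system_def inner_commute[of _ \<alpha>]
      inner_sum_right intro!: Ints_sum Ints_mult)

lemma aff_root_act_inv:
  assumes "crystallographic_root_system \<Phi>" "u \<in> affine_weyl_group \<Phi>" "\<alpha> \<in> \<Phi>"
  shows "aff_root_act (aff_inv u) (aff_root_act u (\<alpha>, k)) = (\<alpha>, k)"
proof -
  obtain w \<mu> where u: "u = (w, \<mu>)" "w \<in> weyl_group \<Phi>" "\<mu> \<in> coroot_lattice \<Phi>"
    using assms by (auto simp: affine_weyl_group_def)
  note w = weyl_group_isometry[OF u(2)]
  obtain m :: int where "\<mu> \<bullet> \<alpha> = of_int m"
    using coroot_lattice_integral[OF assms(1) u(3) assms(3)] by (auto elim: Ints_cases)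
  then show ?thesis using w by (simp add: u(1) bij_is_inj flip: of_int_minus)
qed

end

theory Submission
  imports Defs
begin

text \<open>
  Evaluated at \<open>x\<^sub>0 = \<rho>/h\<close>, affine roots take nonzero values in \<open>(1/h)\<int>\<close>; the positive
  ones are those with positive value, and the simple ones those with value \<open>1/h\<close>. Since
  \<open>u\<^sup>-\<^sup>1 \<beta>\<close> has at \<open>x\<^sub>0\<close> the value of \<open>\<beta>\<close> at \<open>u x\<^sub>0\<close>, the inversions of an element
  sending \<open>x\<^sub>0\<close> to \<open>b x\<^sub>0\<close> are the positive affine roots that are negative at \<open>b x\<^sub>0\<close>.
  As \<open>b\<close> is prime to \<open>h\<close>, the point \<open>b x\<^sub>0\<close> lies on no wall, and reflections carry it into
  the fundamental alcove, in which \<open>x\<^sub>0\<close> is the only point where all simple affine roots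
  have values in \<open>(1/h)\<int>\<close>. Uniqueness says that the stabilizer of \<open>x\<^sub>0\<close> is trivial,
  which follows from the exchange condition.
\<close>

section \<open>Affine functions, their reflections and words of reflections\<close>

text \<open>The affine root \<alpha> + k\<delta> is read as the function x \<mapsto> \<alpha>
  \<bullet> x + k. With this sign of k the action of the affine Weyl group satisfies (u \<beta>)(u
  x) = \<beta>(x).\<close>

definition aff_eval :: "'a::euclidean_space \<times> real \<Rightarrow> 'a \<Rightarrow> real" where
  "aff_eval \<beta> x = fst \<beta> \<bullet> x + snd \<beta>"

text \<open>The orthogonal reflection in the zero set of \<beta>, provided that the gradient
  \<open>fst \<beta>\<close> has squared length 2.\<close>

definition aff_refl :: "'a::euclidean_space \<times> real \<Rightarrow> 'a \<Rightarrow> 'a" where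
  "aff_refl \<beta> x = x - aff_eval \<beta> x *\<^sub>R fst \<beta>"

text \<open>The same reflection acting on affine functions. The multiple of \<beta> is subtracted
  from gradient and constant at once, which is why pairs with a real second component are
  used.\<close>

definition aff_refl_root :: "'a::euclidean_space \<times> real \<Rightarrow> 'a \<times> real \<Rightarrow> 'a \<times> real" where
  "aff_refl_root \<beta> \<gamma> = \<gamma> - (fst \<gamma> \<bullet> fst \<beta>) *\<^sub>R \<beta>"

text \<open>Group elements are represented by lists so that word length is available for inductions.
  The last letter is applied first.\<close>

primrec refl_word :: "('a::euclidean_space \<times> real) list \<Rightarrow> 'a \<Rightarrow> 'a" where
  "refl_word [] x = x"
| "refl_word (\<beta> # \<beta>s) x = aff_refl \<beta> (refl_word \<beta>s x)"

primrec word_root :: "('a::euclidean_space \<times> real) list \<Rightarrow> 'a \<times> real \<Rightarrow> 'a \<times> real" where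
  "word_root [] \<gamma> = \<gamma>"
| "word_root (\<beta> # \<beta>s) \<gamma> = aff_refl_root \<beta> (word_root \<beta>s \<gamma>)"

lemma refl_word_append: "refl_word (xs @ ys) x = refl_word xs (refl_word ys x)"
  by (induction xs) auto

lemma aff_eval_uminus: "aff_eval (- \<beta>) x = - aff_eval \<beta> x"
  by (simp add: aff_eval_def)

lemma aff_refl_uminus: "aff_refl (- \<beta>) = aff_refl \<beta>"
  by (simp add: aff_refl_def aff_eval_uminus fun_eq_iff)

lemma aff_eval_refl_root:
  "aff_eval (aff_refl_root \<beta> \<gamma>) x = aff_eval \<gamma> x - (fst \<gamma> \<bullet> fst \<beta>) * aff_eval \<beta> x"
  by (simp add: aff_eval_def aff_refl_root_def inner_diff_left algebra_simps)

section \<open>Roots and their coefficients in the simple roots\<close>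

locale simply_laced_system =
  fixes \<Phi> \<Delta> :: "'a::euclidean_space set"
  assumes crystallographic: "crystallographic_root_system \<Phi>"
    and irreducible: "irreducible_roots \<Phi>"
    and simple: "simple_roots \<Phi> \<Delta>"
    and laced: "simply_laced \<Phi>"
begin

abbreviation cf :: "'a \<Rightarrow> 'a \<Rightarrow> real" where
  "cf \<equiv> representation \<Delta>"

lemma finite_roots: "finite \<Phi>"
  using crystallographic by (simp add: crystallographic_root_system_def)

lemma inner_root_self: "\<alpha> \<in> \<Phi> \<Longrightarrow> \<alpha> \<bullet> \<alpha> = 2"
  using laced by (simp add: simply_laced_def)

lemma coroot_root: "\<alpha> \<in> \<Phi> \<Longrightarrow> coroot \<alpha> = \<alpha>"
  by (simp add: coroot_def inner_root_self)

lemma root_reflection_root: "\<alpha> \<in> \<Phi> \<Longrightarrow> root_reflection \<alpha> x = x - (x \<bullet> \<alpha>) *\<^sub>R \<alpha>"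
  by (simp add: root_reflection_def coroot_root)

lemma reflect_in_roots: "\<alpha> \<in> \<Phi> \<Longrightarrow> \<beta> \<in> \<Phi> \<Longrightarrow> \<beta> - (\<beta> \<bullet> \<alpha>) *\<^sub>R \<alpha> \<in> \<Phi>"
  using crystallographic root_reflection_root[of \<alpha> \<beta>]
  unfolding crystallographic_root_system_def by (metis imageI)

lemma inner_roots_Ints: "\<alpha> \<in> \<Phi> \<Longrightarrow> \<beta> \<in> \<Phi> \<Longrightarrow> \<alpha> \<bullet> \<beta> \<in> \<int>"
  using crystallographic coroot_root[of \<beta>]
  unfolding crystallographic_root_system_def by (metis)

lemma uminus_root: "\<alpha> \<in> \<Phi> \<Longrightarrow> - \<alpha> \<in> \<Phi>"
  using reflect_in_roots[of \<alpha> \<alpha>] by (simp add: inner_root_self scaleR_2)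

lemma uminus_root_iff: "- \<alpha> \<in> \<Phi> \<longleftrightarrow> \<alpha> \<in> \<Phi>"
  using uminus_root[of \<alpha>] uminus_root[of "- \<alpha>"] by auto

lemma root_nonzero: "\<alpha> \<in> \<Phi> \<Longrightarrow> \<alpha> \<noteq> 0"
  using inner_root_self[of \<alpha>] by auto

text \<open>The squared length of \<alpha> - \<beta> is 4 - 2 (\<alpha> \<bullet> \<beta>). Distinct
  roots therefore have positive pairing at most 1, and in that case their difference is a
  root.\<close>

lemma inner_roots_ge_2_imp_eq:
  assumes "\<alpha> \<in> \<Phi>" "\<beta> \<in> \<Phi>" "\<alpha> \<bullet> \<beta> \<ge> 2"
  shows "\<alpha> = \<beta>"
proof -
  have "(\<alpha> - \<beta>) \<bullet> (\<alpha> - \<beta>) \<le> 0"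
    using assms by (simp add: inner_diff_left inner_diff_right inner_root_self inner_commute)
  then show ?thesis by (metis inner_gt_zero_iff not_le right_minus_eq)
qed

lemma inner_roots_pos_cases:
  assumes "\<alpha> \<in> \<Phi>" "\<beta> \<in> \<Phi>" "\<alpha> \<bullet> \<beta> > 0"
  shows "\<alpha> = \<beta> \<or> \<alpha> \<bullet> \<beta> = 1"
proof -
  obtain n :: int where n: "\<alpha> \<bullet> \<beta> = of_int n"
    using inner_roots_Ints[OF assms(1,2)] by (auto elim: Ints_cases)
  have "n = 1 \<or> n \<ge> 2" using assms(3) n by auto
  then show ?thesis using n inner_roots_ge_2_imp_eq[OF assms(1,2)] by auto
qed

lemma simple_subset: "\<Delta> \<subseteq> \<Phi>" and independent_simple: "independent \<Delta>"
  and span_simple: "span \<Delta> = UNIV"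
  using simple by (auto simp: simple_roots_def)

lemma simple_root: "\<alpha> \<in> \<Delta> \<Longrightarrow> \<alpha> \<in> \<Phi>"
  using simple_subset by auto

lemma finite_simple: "finite \<Delta>"
  using finite_subset[OF simple_subset finite_roots] .

lemma cf_Ints: "\<beta> \<in> \<Phi> \<Longrightarrow> \<alpha> \<in> \<Delta> \<Longrightarrow> cf \<beta> \<alpha> \<in> \<int>"
  using simple by (auto simp: simple_roots_def)

lemma cf_sign: "\<beta> \<in> \<Phi> \<Longrightarrow> (\<forall>\<alpha>\<in>\<Delta>. 0 \<le> cf \<beta> \<alpha>) \<or> (\<forall>\<alpha>\<in>\<Delta>. cf \<beta> \<alpha> \<le> 0)"
  using simple by (auto simp: simple_roots_def)

lemma cf_add: "cf (x + y) \<alpha> = cf x \<alpha> + cf y \<alpha>"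
  using representation_add[OF independent_simple, of y x] span_simple by (auto simp: add.commute)

lemma cf_diff: "cf (x - y) \<alpha> = cf x \<alpha> - cf y \<alpha>"
  using representation_diff[OF independent_simple, of y x] span_simple by auto

lemma cf_scale: "cf (r *\<^sub>R x) \<alpha> = r * cf x \<alpha>"
  using representation_scale[OF independent_simple, of x r] span_simple by auto

lemma cf_uminus: "cf (- x) \<alpha> = - cf x \<alpha>"
  using cf_scale[of "-1" x] by simp

lemma cf_simple: "\<alpha> \<in> \<Delta> \<Longrightarrow> cf \<alpha> \<beta> = (if \<beta> = \<alpha> then 1 else 0)"
  using representation_basis[OF independent_simple] by auto

lemma cf_expand: "x = (\<Sum>\<alpha>\<in>\<Delta>. cf x \<alpha> *\<^sub>R \<alpha>)"
  using sum_representation_eq[OF independent_simple, of x \<Delta>] finite_simple span_simple by auto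

lemma inner_expand: "x \<bullet> y = (\<Sum>\<alpha>\<in>\<Delta>. cf x \<alpha> * (\<alpha> \<bullet> y))"
  by (subst cf_expand[of x]) (simp add: inner_sum_left)

lemma eq_if_inner_simple_eq: "(\<And>\<alpha>. \<alpha> \<in> \<Delta> \<Longrightarrow> \<alpha> \<bullet> x = \<alpha> \<bullet> y) \<Longrightarrow> x = y"
proof -
  assume "\<And>\<alpha>. \<alpha> \<in> \<Delta> \<Longrightarrow> \<alpha> \<bullet> x = \<alpha> \<bullet> y"
  then have "v \<bullet> x = v \<bullet> y" for v by (simp add: inner_expand[of v])
  then show "x = y" by (metis vector_eq_ldot)
qed

lemma eq_if_cf_eq: "(\<And>\<alpha>. \<alpha> \<in> \<Delta> \<Longrightarrow> cf x \<alpha> = cf y \<alpha>) \<Longrightarrow> x = y"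
  using cf_expand[of x] cf_expand[of y] by simp

text \<open>A positive pairing would make \<alpha> - \<beta> a root, with coefficients 1 and -1 of
  opposite sign.\<close>

lemma inner_simple_nonpos:
  assumes "\<alpha> \<in> \<Delta>" "\<beta> \<in> \<Delta>" "\<alpha> \<noteq> \<beta>"
  shows "\<alpha> \<bullet> \<beta> \<le> 0"
proof (rule ccontr)
  assume "\<not> \<alpha> \<bullet> \<beta> \<le> 0"
  then have "\<alpha> \<bullet> \<beta> = 1"
    using inner_roots_pos_cases[of \<alpha> \<beta>] assms simple_root by auto
  then have "\<alpha> - \<beta> \<in> \<Phi>"
    using reflect_in_roots[of \<beta> \<alpha>] assms simple_root by auto
  from cf_sign[OF this] have "cf (\<alpha> - \<beta>) \<alpha> \<le> 0 \<or> cf (\<alpha> - \<beta>) \<beta> \<ge> 0"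
    using assms by auto
  then show False using assms by (auto simp: cf_diff cf_simple)
qed

section \<open>Dominant roots and the highest root\<close>

definition dominant :: "'a \<Rightarrow> bool" where
  "dominant \<beta> \<longleftrightarrow> \<beta> \<in> \<Phi> \<and> (\<forall>\<alpha>\<in>\<Delta>. \<alpha> \<bullet> \<beta> \<ge> 0)"

text \<open>Adding n \<alpha> to a lattice vector r changes half the squared norm by n * n + n
  (\<alpha> \<bullet> r), because \<alpha> has squared length 2.\<close>

lemma even_lattice:
  assumes "finite J" "J \<subseteq> \<Delta>" "\<And>\<alpha>. \<alpha> \<in> J \<Longrightarrow> n \<alpha> \<in> \<int>"
  shows "(\<Sum>\<alpha>\<in>J. n \<alpha> *\<^sub>R \<alpha>) \<bullet> (\<Sum>\<alpha>\<in>J. n \<alpha> *\<^sub>R \<alpha>) / 2 \<in> \<int>"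
  using assms
proof (induction J)
  case (insert \<alpha> J)
  let ?r = "\<Sum>\<beta>\<in>J. n \<beta> *\<^sub>R \<beta>"
  have 1: "?r \<bullet> ?r / 2 \<in> \<int>" using insert by auto
  have 2: "\<alpha> \<bullet> ?r \<in> \<int>"
    unfolding inner_sum_right inner_scaleR_right
    using insert.prems simple_root by (intro Ints_sum Ints_mult inner_roots_Ints) auto
  have "(n \<alpha> *\<^sub>R \<alpha> + ?r) \<bullet> (n \<alpha> *\<^sub>R \<alpha> + ?r) / 2 = n \<alpha> * n \<alpha> + n \<alpha> * (\<alpha> \<bullet> ?r) + ?r \<bullet> ?r / 2"
    using inner_root_self[OF simple_root[of \<alpha>]] insert.prems
    by (simp add: inner_add_left inner_add_right inner_commute field_simps)
  moreover have "n \<alpha> * n \<alpha> + n \<alpha> * (\<alpha> \<bullet> ?r) + ?r \<bullet> ?r / 2 \<in> \<int>"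
    using 1 2 insert.prems by (intro Ints_add Ints_mult) auto
  ultimately show ?case unfolding sum.insert[OF insert.hyps(1,2)] by metis
qed auto

text \<open>A root splits along an orthogonal decomposition of the simple roots into two lattice vectors
  of even norm whose norms add up to 2, so one part vanishes.\<close>

lemma no_orthogonal_splitting:
  assumes "J \<subseteq> \<Delta>" "J \<noteq> {}" and orth: "\<And>\<alpha> \<beta>. \<alpha> \<in> J \<Longrightarrow> \<beta> \<in> \<Delta> - J \<Longrightarrow> \<alpha> \<bullet> \<beta> = 0"
  shows "J = \<Delta>"
proof (rule ccontr)
  assume "J \<noteq> \<Delta>"
  define p where "p I x = (\<Sum>\<alpha>\<in>I. cf x \<alpha> *\<^sub>R \<alpha>)" for I x
  \<comment> \<open>A and B collect the roots carried by J and by its complement; they are to form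
    the decomposition that irreducibility forbids.\<close>
  define A where "A = {\<beta> \<in> \<Phi>. p J \<beta> = \<beta>}"
  define B where "B = {\<beta> \<in> \<Phi>. p (\<Delta> - J) \<beta> = \<beta>}"
  have fin: "finite J" using assms finite_simple finite_subset by blast
  have orth_p: "p J x \<bullet> p (\<Delta> - J) y = 0" for x y
    unfolding p_def inner_sum_left inner_sum_right
    by (intro sum.neutral ballI) (simp add: orth)
  have split: "p J x + p (\<Delta> - J) x = x" for x
    using sum.subset_diff[OF assms(1) finite_simple, of "\<lambda>\<alpha>. cf x \<alpha> *\<^sub>R \<alpha>"] cf_expand[of x]
    by (simp add: p_def add.commute)
  have "\<beta> \<in> A \<union> B" if "\<beta> \<in> \<Phi>" for \<beta>
  proof -
    let ?x = "p J \<beta>" and ?y = "p (\<Delta> - J) \<beta>"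
    have "?x \<bullet> ?x / 2 \<in> \<int>" "?y \<bullet> ?y / 2 \<in> \<int>"
      unfolding p_def using fin finite_simple assms(1) cf_Ints[OF that]
      by (intro even_lattice; auto)+
    then obtain m n :: int where mn: "?x \<bullet> ?x = 2 * of_int m" "?y \<bullet> ?y = 2 * of_int n"
      by (metis Ints_cases field_sum_of_halves mult_2 nonzero_mult_div_cancel_left times_divide_eq_right zero_neq_numeral)
    have "(?x + ?y) \<bullet> (?x + ?y) = ?x \<bullet> ?x + ?y \<bullet> ?y"
      using orth_p[of \<beta> \<beta>] by (simp add: inner_add_left inner_add_right inner_commute[of ?y ?x])
    then have "2 = ?x \<bullet> ?x + ?y \<bullet> ?y"
      using inner_root_self[OF that] split[of \<beta>] by simp
    then have "real_of_int (m + n) = 1" using mn by simp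
    then have "m + n = 1" by linarith
    moreover have "m \<ge> 0" "n \<ge> 0"
      using mn inner_ge_zero[of ?x] inner_ge_zero[of ?y] by auto
    ultimately have "m = 0 \<or> n = 0" by auto
    then have "?x = 0 \<or> ?y = 0" using mn by auto
    then show ?thesis using split[of \<beta>] that by (auto simp: A_def B_def)
  qed
  then have "A \<union> B = \<Phi>" by (auto simp: A_def B_def)
  moreover have "\<alpha> \<bullet> \<beta> = 0" if "\<alpha> \<in> A" "\<beta> \<in> B" for \<alpha> \<beta>
    using that orth_p[of \<alpha> \<beta>] by (auto simp: A_def B_def)
  moreover have "A \<inter> B = {}"
  proof -
    have "\<alpha> \<bullet> \<alpha> = 0" if "\<alpha> \<in> A \<inter> B" for \<alpha>
      using that orth_p[of \<alpha> \<alpha>] by (auto simp: A_def B_def)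
    then show ?thesis using inner_root_self by (fastforce simp: A_def)
  qed
  moreover have "I \<subseteq> \<Delta> \<Longrightarrow> \<alpha> \<in> I \<Longrightarrow> p I \<alpha> = \<alpha>" for I \<alpha>
  proof -
    assume I: "I \<subseteq> \<Delta>" "\<alpha> \<in> I"
    then have "p I \<alpha> = (\<Sum>\<beta>\<in>I. if \<beta> = \<alpha> then \<alpha> else 0)"
      unfolding p_def by (intro sum.cong) (auto simp: cf_simple)
    then show "p I \<alpha> = \<alpha>" using I finite_subset[OF I(1) finite_simple] by simp
  qed
  then have "J \<subseteq> A" "\<Delta> - J \<subseteq> B" using assms(1) simple_root by (auto simp: A_def B_def)
  then have "A \<noteq> {}" "B \<noteq> {}" using assms \<open>J \<noteq> \<Delta>\<close> by auto
  ultimately show False using irreducible unfolding irreducible_roots_def by metis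
qed

text \<open>Let J be the simple roots with positive coefficient. For \<delta> outside J, the
  expansion of \<beta> \<bullet> \<delta> has only nonpositive terms, while dominance makes the
  total nonnegative. All terms vanish, so J is orthogonal to its complement and must be
  everything.\<close>

lemma dominant_full_support:
  assumes "dominant \<beta>" "\<alpha> \<in> \<Delta>"
  shows "cf \<beta> \<alpha> \<ge> 1"
proof -
  have root: "\<beta> \<in> \<Phi>" and dom: "\<And>\<alpha>. \<alpha> \<in> \<Delta> \<Longrightarrow> \<alpha> \<bullet> \<beta> \<ge> 0"
    using assms by (auto simp: dominant_def)
  define J where "J = {\<alpha> \<in> \<Delta>. cf \<beta> \<alpha> > 0}"
  have "J \<noteq> {}"
  proof
    assume "J = {}"
    then have "(\<Sum>\<alpha>\<in>\<Delta>. cf \<beta> \<alpha> * (\<alpha> \<bullet> \<beta>)) \<le> 0"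
      using dom by (intro sum_nonpos) (auto simp: J_def not_less mult_nonpos_nonneg)
    then show False using inner_expand[of \<beta> \<beta>] inner_root_self[OF root] by simp
  qed
  then have nonneg: "cf \<beta> \<gamma> \<ge> 0" if "\<gamma> \<in> \<Delta>" for \<gamma>
    using cf_sign[OF root] that by (force simp: J_def)
  have "\<gamma> \<bullet> \<delta> = 0" if "\<gamma> \<in> J" "\<delta> \<in> \<Delta> - J" for \<gamma> \<delta>
  proof -
    have le: "cf \<beta> \<epsilon> * (\<epsilon> \<bullet> \<delta>) \<le> 0" if "\<epsilon> \<in> \<Delta>" for \<epsilon>
    proof (cases "\<epsilon> = \<delta>")
      case True
      then have "cf \<beta> \<epsilon> = 0"
        using \<open>\<delta> \<in> \<Delta> - J\<close> nonneg[of \<delta>] by (auto simp: J_def)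
      then show ?thesis by simp
    next
      case False
      then show ?thesis
        using inner_simple_nonpos[of \<epsilon> \<delta>] \<open>\<delta> \<in> \<Delta> - J\<close> that nonneg[of \<epsilon>]
        by (auto simp: mult_nonneg_nonpos)
    qed
    have "(\<Sum>\<epsilon>\<in>\<Delta>. - (cf \<beta> \<epsilon> * (\<epsilon> \<bullet> \<delta>))) \<le> 0"
      using dom[of \<delta>] that inner_expand[of \<beta> \<delta>] by (simp add: sum_negf inner_commute)
    moreover have "(\<Sum>\<epsilon>\<in>\<Delta>. - (cf \<beta> \<epsilon> * (\<epsilon> \<bullet> \<delta>))) \<ge> 0"
      using le by (intro sum_nonneg) simp
    ultimately have "(\<Sum>\<epsilon>\<in>\<Delta>. - (cf \<beta> \<epsilon> * (\<epsilon> \<bullet> \<delta>))) = 0" by simp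
    then have "\<forall>\<epsilon>\<in>\<Delta>. - (cf \<beta> \<epsilon> * (\<epsilon> \<bullet> \<delta>)) = 0"
      using le by (subst (asm) sum_nonneg_eq_0_iff[OF finite_simple]) auto
    then show ?thesis using that by (auto simp: J_def)
  qed
  then have "J = \<Delta>"
    using \<open>J \<noteq> {}\<close> by (intro no_orthogonal_splitting) (auto simp: J_def)
  then have "cf \<beta> \<alpha> > 0" using assms by (auto simp: J_def)
  moreover obtain n :: int where "cf \<beta> \<alpha> = of_int n"
    using cf_Ints[OF root assms(2)] by (auto elim: Ints_cases)
  ultimately show ?thesis by simp
qed

text \<open>Full support forces \<beta> \<bullet> \<gamma> > 0, hence equal to 1 for distinct roots,
  and \<beta> - \<gamma> is a root. It pairs to 1 with \<beta> and to -1 with \<gamma>. If its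
  coefficients are nonnegative the second value contradicts dominance of \<gamma>, if nonpositive
  the first contradicts dominance of \<beta>.\<close>

lemma dominant_unique:
  assumes "dominant \<beta>" "dominant \<gamma>"
  shows "\<beta> = \<gamma>"
proof (rule ccontr)
  assume "\<beta> \<noteq> \<gamma>"
  have roots: "\<beta> \<in> \<Phi>" "\<gamma> \<in> \<Phi>" using assms by (auto simp: dominant_def)
  have nonneg: "cf \<beta> \<alpha> * (\<alpha> \<bullet> \<gamma>) \<ge> 0" if "\<alpha> \<in> \<Delta>" for \<alpha>
    using dominant_full_support[OF assms(1) that] assms(2) that
    by (auto simp: dominant_def)
  have "\<beta> \<bullet> \<gamma> > 0"
  proof (rule ccontr)
    assume "\<not> \<beta> \<bullet> \<gamma> > 0"
    then have "(\<Sum>\<alpha>\<in>\<Delta>. cf \<beta> \<alpha> * (\<alpha> \<bullet> \<gamma>)) = 0"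
      using sum_nonneg[of \<Delta> "\<lambda>\<alpha>. cf \<beta> \<alpha> * (\<alpha> \<bullet> \<gamma>)"] nonneg inner_expand[of \<beta> \<gamma>] by simp
    then have "\<forall>\<alpha>\<in>\<Delta>. cf \<beta> \<alpha> * (\<alpha> \<bullet> \<gamma>) = 0"
      using nonneg by (subst (asm) sum_nonneg_eq_0_iff[OF finite_simple]) auto
    \<comment> \<open>The coefficients of \<beta> are at least 1, so it is the pairings that
      vanish.\<close>
    then have "\<alpha> \<bullet> \<gamma> = \<alpha> \<bullet> 0" if "\<alpha> \<in> \<Delta>" for \<alpha>
      using dominant_full_support[OF assms(1) that] that by fastforce
    then have "\<gamma> = 0" by (rule eq_if_inner_simple_eq)
    then show False using root_nonzero roots by auto
  qed
  then have 1: "\<beta> \<bullet> \<gamma> = 1" using inner_roots_pos_cases[OF roots] \<open>\<beta> \<noteq> \<gamma>\<close> by auto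
  then have root: "\<beta> - \<gamma> \<in> \<Phi>" using reflect_in_roots[OF roots(2,1)] by simp
  have "(\<beta> - \<gamma>) \<bullet> \<gamma> = -1" "(\<beta> - \<gamma>) \<bullet> \<beta> = 1"
    using 1 inner_root_self roots by (auto simp: inner_diff_left inner_commute[of \<gamma> \<beta>])
  moreover have "(\<beta> - \<gamma>) \<bullet> \<gamma> \<ge> 0" if "\<forall>\<alpha>\<in>\<Delta>. 0 \<le> cf (\<beta> - \<gamma>) \<alpha>"
    unfolding inner_expand[of "\<beta> - \<gamma>"] using assms(2) that
    by (intro sum_nonneg) (auto simp: dominant_def)
  moreover have "(\<beta> - \<gamma>) \<bullet> \<beta> \<le> 0" if "\<forall>\<alpha>\<in>\<Delta>. cf (\<beta> - \<gamma>) \<alpha> \<le> 0"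
    unfolding inner_expand[of "\<beta> - \<gamma>"] using assms(1) that
    by (intro sum_nonpos) (auto simp: dominant_def mult_nonpos_nonneg)
  ultimately show False using cf_sign[OF root] by auto
qed

text \<open>Among the roots above \<beta> take one of maximal height. A simple root pairing
  negatively with it would give a reflected root that is still above \<beta> and higher.\<close>

lemma exists_dominant_above:
  assumes "\<beta> \<in> \<Phi>"
  obtains \<gamma> where "dominant \<gamma>" "\<And>\<alpha>. \<alpha> \<in> \<Delta> \<Longrightarrow> cf \<beta> \<alpha> \<le> cf \<gamma> \<alpha>"
proof -
  define U where "U = {\<gamma> \<in> \<Phi>. \<forall>\<alpha>\<in>\<Delta>. cf \<beta> \<alpha> \<le> cf \<gamma> \<alpha>}"
  define f where "f \<gamma> = (\<Sum>\<alpha>\<in>\<Delta>. cf \<gamma> \<alpha>)" for \<gamma>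
  have "finite U" "U \<noteq> {}" using finite_roots assms by (auto simp: U_def)
  then obtain \<gamma> where \<gamma>U: "\<gamma> \<in> U" and "f \<gamma> = Max (f ` U)"
    using obtains_MAX[of U f] by metis
  then have \<gamma>: "\<gamma> \<in> U" "\<And>\<delta>. \<delta> \<in> U \<Longrightarrow> f \<delta> \<le> f \<gamma>"
    using \<open>finite U\<close> by auto
  have "\<alpha> \<bullet> \<gamma> \<ge> 0" if \<alpha>: "\<alpha> \<in> \<Delta>" for \<alpha>
  proof (rule ccontr)
    assume neg: "\<not> \<alpha> \<bullet> \<gamma> \<ge> 0"
    let ?\<delta> = "\<gamma> - (\<gamma> \<bullet> \<alpha>) *\<^sub>R \<alpha>"
    have cf: "cf ?\<delta> \<epsilon> = cf \<gamma> \<epsilon> - (if \<epsilon> = \<alpha> then \<gamma> \<bullet> \<alpha> else 0)" for \<epsilon>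
      using \<alpha> by (simp add: cf_diff cf_scale cf_simple)
    have "cf \<beta> \<epsilon> \<le> cf ?\<delta> \<epsilon>" if "\<epsilon> \<in> \<Delta>" for \<epsilon>
      using \<gamma>(1) neg that unfolding cf by (auto simp: U_def inner_commute[of \<gamma>] intro: order_trans)
    then have "?\<delta> \<in> U"
      using \<gamma>(1) reflect_in_roots[OF simple_root[OF \<alpha>], of \<gamma>] by (auto simp: U_def)
    moreover have "f ?\<delta> = f \<gamma> - \<gamma> \<bullet> \<alpha>"
      using \<alpha> finite_simple by (simp add: f_def cf sum_subtractf)
    ultimately show False using \<gamma>(2)[of ?\<delta>] neg by (simp add: inner_commute)
  qed
  then have "dominant \<gamma>" using \<gamma>(1) by (auto simp: dominant_def U_def)
  then show thesis using that \<gamma>(1) by (auto simp: U_def)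
qed

abbreviation \<theta> :: 'a where "\<theta> \<equiv> highest_root \<Phi> \<Delta>"

text \<open>By uniqueness, the dominant roots found above the various roots all coincide, so this
  one root bounds every other. This also shows that the description in \<open>highest_root\<close>
  denotes.\<close>

lemma highest_root: "dominant \<theta>" "\<beta> \<in> \<Phi> \<Longrightarrow> \<alpha> \<in> \<Delta> \<Longrightarrow> cf \<beta> \<alpha> \<le> cf \<theta> \<alpha>"
proof -
  obtain \<beta>0 where "\<beta>0 \<in> \<Phi>" using irreducible by (auto simp: irreducible_roots_def)
  then obtain \<gamma> where dom: "dominant \<gamma>" using exists_dominant_above by metis
  have above: "cf \<beta> \<alpha> \<le> cf \<gamma> \<alpha>" if "\<beta> \<in> \<Phi>" "\<alpha> \<in> \<Delta>" for \<beta> \<alpha>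
    using exists_dominant_above[OF that(1)] dominant_unique[OF dom] that(2) by metis
  have "\<theta> = \<gamma>"
    unfolding highest_root_def
  proof (rule the_equality)
    show "\<gamma> \<in> \<Phi> \<and> (\<forall>\<beta>\<in>\<Phi>. \<forall>\<alpha>\<in>\<Delta>. cf \<beta> \<alpha> \<le> cf \<gamma> \<alpha>)"
      using dom above by (auto simp: dominant_def)
    show "\<delta> = \<gamma>" if "\<delta> \<in> \<Phi> \<and> (\<forall>\<beta>\<in>\<Phi>. \<forall>\<alpha>\<in>\<Delta>. cf \<beta> \<alpha> \<le> cf \<delta> \<alpha>)" for \<delta>
      using that above dom by (intro eq_if_cf_eq antisym) (auto simp: dominant_def)
  qed
  then show "dominant \<theta>" "\<beta> \<in> \<Phi> \<Longrightarrow> \<alpha> \<in> \<Delta> \<Longrightarrow> cf \<beta> \<alpha> \<le> cf \<theta> \<alpha>"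
    using dom above by auto
qed

lemma highest_in_roots: "\<theta> \<in> \<Phi>"
  using highest_root by (simp add: dominant_def)

section \<open>Coweights, heights and the Coxeter number\<close>

lemma inner_fund_coweight:
  assumes "\<alpha> \<in> \<Delta>" "\<beta> \<in> \<Delta>"
  shows "\<beta> \<bullet> fund_coweight \<Delta> \<alpha> = (if \<beta> = \<alpha> then 1 else 0)"
proof -
  have lin: "linear (\<lambda>x. cf x \<alpha>)"
    by (rule linearI) (simp_all add: cf_add cf_scale)
  \<comment> \<open>The coweight is the vector representing the coordinate functional of \<alpha>,
    obtained as the adjoint of that functional applied to 1.\<close>
  define \<omega> where "\<omega> = adjoint (\<lambda>x. cf x \<alpha>) 1"
  have \<omega>: "x \<bullet> \<omega> = cf x \<alpha>" for x
    using adjoint_works[OF lin, of x 1] by (simp add: \<omega>_def)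
  have "fund_coweight \<Delta> \<alpha> = \<omega>"
    unfolding fund_coweight_def
  proof (rule the_equality)
    show "\<forall>\<beta>\<in>\<Delta>. \<omega> \<bullet> \<beta> = (if \<beta> = \<alpha> then 1 else 0)"
      by (auto simp: \<omega> cf_simple inner_commute[of \<omega>])
    show "\<omega>' = \<omega>" if "\<forall>\<beta>\<in>\<Delta>. \<omega>' \<bullet> \<beta> = (if \<beta> = \<alpha> then 1 else 0)" for \<omega>'
      by (rule eq_if_inner_simple_eq) (use that in \<open>auto simp: \<omega> cf_simple inner_commute[of _ \<omega>']\<close>)
  qed
  then show ?thesis using assms by (auto simp: \<omega> cf_simple)
qed

lemma inner_rho_simple: "\<alpha> \<in> \<Delta> \<Longrightarrow> \<alpha> \<bullet> rho_check \<Delta> = 1"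
  using finite_simple by (simp add: rho_check_def inner_sum_right inner_fund_coweight)

lemma inner_rho: "x \<bullet> rho_check \<Delta> = (\<Sum>\<alpha>\<in>\<Delta>. cf x \<alpha>)"
  by (simp add: inner_expand[of x] inner_rho_simple)

lemma ht_eq: "\<beta> \<in> \<Phi> \<Longrightarrow> of_int (ht \<Delta> \<beta>) = \<beta> \<bullet> rho_check \<Delta>"
proof -
  assume "\<beta> \<in> \<Phi>"
  then have "(\<Sum>\<alpha>\<in>\<Delta>. cf \<beta> \<alpha>) \<in> \<int>" by (intro Ints_sum cf_Ints)
  then show ?thesis by (auto simp: ht_def inner_rho elim: Ints_cases)
qed

text \<open>The pairing with \<open>rho_check \<Delta>\<close> is the sum of the coefficients. These
  share a sign and are not all zero, so the sum decides which sign it is.\<close>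

lemma pos_roots_iff: "\<beta> \<in> pos_roots \<Phi> \<Delta> \<longleftrightarrow> \<beta> \<in> \<Phi> \<and> 0 < \<beta> \<bullet> rho_check \<Delta>"
proof -
  have "(\<forall>\<alpha>\<in>\<Delta>. 0 \<le> cf \<beta> \<alpha>) \<longleftrightarrow> 0 < \<beta> \<bullet> rho_check \<Delta>" if "\<beta> \<in> \<Phi>"
  proof
    assume nonneg: "\<forall>\<alpha>\<in>\<Delta>. 0 \<le> cf \<beta> \<alpha>"
    have "(\<Sum>\<alpha>\<in>\<Delta>. cf \<beta> \<alpha>) \<noteq> 0"
    proof
      assume "(\<Sum>\<alpha>\<in>\<Delta>. cf \<beta> \<alpha>) = 0"
      then have "\<forall>\<alpha>\<in>\<Delta>. cf \<beta> \<alpha> = 0"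
        using nonneg by (subst (asm) sum_nonneg_eq_0_iff[OF finite_simple]) auto
      then have "\<beta> = 0" using cf_expand[of \<beta>] by simp
      then show False using root_nonzero that by auto
    qed
    then show "0 < \<beta> \<bullet> rho_check \<Delta>"
      using nonneg sum_nonneg[of \<Delta> "cf \<beta>"] by (simp add: inner_rho less_le)
  next
    assume "0 < \<beta> \<bullet> rho_check \<Delta>"
    then have "\<not> (\<forall>\<alpha>\<in>\<Delta>. cf \<beta> \<alpha> \<le> 0)"
      using sum_nonpos[of \<Delta> "cf \<beta>"] by (auto simp: inner_rho)
    then show "\<forall>\<alpha>\<in>\<Delta>. 0 \<le> cf \<beta> \<alpha>" using cf_sign[OF that] by auto
  qed
  then show ?thesis by (auto simp: pos_roots_def)
qed

lemma pos_or_neg: "\<beta> \<in> \<Phi> \<Longrightarrow> \<beta> \<in> pos_roots \<Phi> \<Delta> \<or> - \<beta> \<in> pos_roots \<Phi> \<Delta>"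
  using cf_sign[of \<beta>] uminus_root[of \<beta>] by (auto simp: pos_roots_def cf_uminus)

abbreviation h :: real where "h \<equiv> of_int (coxeter_number \<Phi> \<Delta>)"

lemma h_eq: "h = 1 + \<theta> \<bullet> rho_check \<Delta>"
  by (simp add: coxeter_number_def ht_eq highest_in_roots)

lemma h_ge_2: "h \<ge> 2"
proof -
  have "\<theta> \<in> pos_roots \<Phi> \<Delta>"
    using dominant_full_support[OF highest_root(1)] highest_in_roots
    by (auto simp: pos_roots_def intro: order_trans[of 0 1])
  then have "0 < ht \<Delta> \<theta>"
    using ht_eq[OF highest_in_roots] by (auto simp: pos_roots_iff)
  then show ?thesis by (simp add: coxeter_number_def)
qed

lemma rho_bounds:
  assumes "\<beta> \<in> pos_roots \<Phi> \<Delta>"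
  shows "1 \<le> \<beta> \<bullet> rho_check \<Delta>" "\<beta> \<bullet> rho_check \<Delta> \<le> h - 1"
proof -
  have root: "\<beta> \<in> \<Phi>" and "0 < \<beta> \<bullet> rho_check \<Delta>" using assms by (auto simp: pos_roots_iff)
  then show "1 \<le> \<beta> \<bullet> rho_check \<Delta>" using ht_eq[OF root] by (metis of_int_0_less_iff of_int_1_le_iff int_one_le_iff_zero_less)
  show "\<beta> \<bullet> rho_check \<Delta> \<le> h - 1"
    using highest_root(2)[OF root] by (simp add: h_eq inner_rho sum_mono)
qed

section \<open>Affine roots and their reflections\<close>

text \<open>The second component of an affine root is a real number, so that affine roots
  form a subset of a vector space.\<close>

definition aff_roots :: "('a \<times> real) set" where
  "aff_roots = \<Phi> \<times> \<int>"

lemma aff_root_self: "\<beta> \<in> aff_roots \<Longrightarrow> fst \<beta> \<bullet> fst \<beta> = 2"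
  by (auto simp: aff_roots_def inner_root_self)

lemma uminus_aff_root: "\<beta> \<in> aff_roots \<Longrightarrow> - \<beta> \<in> aff_roots"
  by (cases \<beta>) (auto simp: aff_roots_def uminus_root)

lemma aff_eval_refl: "\<beta> \<in> aff_roots \<Longrightarrow> aff_eval \<beta> (aff_refl \<beta> x) = - aff_eval \<beta> x"
  using aff_root_self[of \<beta>] by (simp add: aff_eval_def aff_refl_def inner_diff_right algebra_simps)

lemma aff_refl_involution: "\<beta> \<in> aff_roots \<Longrightarrow> aff_refl \<beta> (aff_refl \<beta> x) = x"
  by (simp add: aff_refl_def[of \<beta> "aff_refl \<beta> x"] aff_eval_refl) (simp add: aff_refl_def)

lemma aff_eval_refl_refl:
  assumes "\<beta> \<in> aff_roots"
  shows "aff_eval (aff_refl_root \<beta> \<gamma>) (aff_refl \<beta> x) = aff_eval \<gamma> x"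
  unfolding aff_eval_refl_root aff_eval_refl[OF assms]
  by (simp add: aff_refl_def aff_eval_def inner_diff_right algebra_simps)

lemma aff_eval_refl_swap:
  assumes "\<beta> \<in> aff_roots"
  shows "aff_eval \<gamma> (aff_refl \<beta> x) = aff_eval (aff_refl_root \<beta> \<gamma>) x"
  using aff_eval_refl_refl[OF assms, of \<gamma> "aff_refl \<beta> x"] aff_refl_involution[OF assms] by simp

lemma aff_refl_root_in: "\<beta> \<in> aff_roots \<Longrightarrow> \<gamma> \<in> aff_roots \<Longrightarrow> aff_refl_root \<beta> \<gamma> \<in> aff_roots"
  by (cases \<beta>; cases \<gamma>)
    (auto simp: aff_roots_def aff_refl_root_def reflect_in_roots inner_roots_Ints)

text \<open>Conjugating a reflection by another reflection moves its mirror, and the mirror moves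
  with the affine root.\<close>

lemma aff_refl_conj:
  assumes "\<beta> \<in> aff_roots"
  shows "aff_refl \<beta> (aff_refl \<alpha> x) = aff_refl (aff_refl_root \<beta> \<alpha>) (aff_refl \<beta> x)"
proof -
  have "aff_refl (aff_refl_root \<beta> \<alpha>) (aff_refl \<beta> x) = aff_refl \<beta> x - aff_eval \<alpha> x *\<^sub>R fst (aff_refl_root \<beta> \<alpha>)"
    by (simp add: aff_refl_def[of "aff_refl_root \<beta> \<alpha>"] aff_eval_refl_refl[OF assms])
  then show ?thesis
    by (simp add: aff_refl_def aff_eval_def aff_refl_root_def inner_diff_right algebra_simps inner_commute)
qed

lemma word_root_in: "set ws \<subseteq> aff_roots \<Longrightarrow> \<gamma> \<in> aff_roots \<Longrightarrow> word_root ws \<gamma> \<in> aff_roots"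
  by (induction ws) (auto intro: aff_refl_root_in)

lemma aff_eval_word: "set ws \<subseteq> aff_roots \<Longrightarrow> aff_eval (word_root ws \<gamma>) (refl_word ws x) = aff_eval \<gamma> x"
  by (induction ws) (auto simp: aff_eval_refl_refl)

lemma refl_word_conj:
  "set ws \<subseteq> aff_roots \<Longrightarrow> refl_word ws (aff_refl \<alpha> x) = aff_refl (word_root ws \<alpha>) (refl_word ws x)"
  by (induction ws) (auto simp: aff_refl_conj)

lemma refl_word_rev: "set ws \<subseteq> aff_roots \<Longrightarrow> refl_word (rev ws) (refl_word ws x) = x"
  by (induction ws) (auto simp: aff_refl_involution refl_word_append)

section \<open>Values at \<open>x0\<close> and the simple affine roots\<close>

definition x0 :: 'a where "x0 = (1 / h) *\<^sub>R rho_check \<Delta>"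

abbreviation val :: "'a \<times> real \<Rightarrow> real" where "val \<beta> \<equiv> aff_eval \<beta> x0"

lemma h_times_inner_x0: "h * (v \<bullet> x0) = v \<bullet> rho_check \<Delta>"
  using h_ge_2 by (simp add: x0_def)

lemma h_times_val: "h * val \<beta> = fst \<beta> \<bullet> rho_check \<Delta> + h * snd \<beta>"
  by (simp add: aff_eval_def distrib_left h_times_inner_x0)

lemma inner_x0_bounds:
  assumes "\<beta> \<in> pos_roots \<Phi> \<Delta>"
  shows "0 < \<beta> \<bullet> x0" "\<beta> \<bullet> x0 < 1"
proof -
  have "0 < h * (\<beta> \<bullet> x0)" "h * (\<beta> \<bullet> x0) < h * 1"
    using rho_bounds[OF assms] by (simp_all add: h_times_inner_x0)
  then show "0 < \<beta> \<bullet> x0" "\<beta> \<bullet> x0 < 1"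
    using h_ge_2 by (simp_all add: zero_less_mult_iff)
qed

text \<open>Up to sign the value lies strictly between 0 and 1. Hence \<open>x0\<close> is on no
  wall.\<close>

lemma inner_x0_Ints:
  assumes "\<beta> \<in> \<Phi>" shows "\<beta> \<bullet> x0 \<notin> \<int>"
proof
  assume "\<beta> \<bullet> x0 \<in> \<int>"
  then obtain n :: int where n: "\<beta> \<bullet> x0 = of_int n" by (auto elim: Ints_cases)
  from pos_or_neg[OF assms] show False
    using inner_x0_bounds[of \<beta>] inner_x0_bounds[of "- \<beta>"] n by auto
qed

lemma val_nonzero: "\<beta> \<in> aff_roots \<Longrightarrow> val \<beta> \<noteq> 0"
  using inner_x0_Ints[of "fst \<beta>"]
  by (auto simp: aff_roots_def aff_eval_def eq_neg_iff_add_eq_0[symmetric])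

lemma h_val_Ints: "\<beta> \<in> aff_roots \<Longrightarrow> h * val \<beta> \<in> \<int>"
  unfolding h_times_val using ht_eq[of "fst \<beta>", symmetric]
  by (auto simp: aff_roots_def)

lemma h_val_ge_1:
  assumes "\<beta> \<in> aff_roots" "val \<beta> > 0"
  shows "h * val \<beta> \<ge> 1"
proof -
  obtain n :: int where n: "h * val \<beta> = of_int n"
    using h_val_Ints[OF assms(1)] by (auto elim: Ints_cases)
  have "h * val \<beta> > 0" using assms(2) h_ge_2 by simp
  then show ?thesis using n by simp
qed

text \<open>These are the simple roots and \<open>- \<theta> + \<delta>\<close>.\<close>

definition simple_aff :: "('a \<times> real) set" where
  "simple_aff = {\<beta> \<in> aff_roots. h * val \<beta> = 1}"

lemma simple_aff_root: "\<beta> \<in> simple_aff \<Longrightarrow> \<beta> \<in> aff_roots"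
  by (simp add: simple_aff_def)

lemma simple_aff_pos: "\<beta> \<in> simple_aff \<Longrightarrow> val \<beta> > 0"
  using h_ge_2 zero_less_mult_iff[of h "val \<beta>"] by (simp add: simple_aff_def)

lemma simple_in_simple_aff: "\<alpha> \<in> \<Delta> \<Longrightarrow> (\<alpha>, 0) \<in> simple_aff"
  by (simp add: simple_aff_def aff_roots_def simple_root h_times_val inner_rho_simple)

lemma lowest_in_simple_aff: "(- \<theta>, 1) \<in> simple_aff"
  using h_times_val[of "(- \<theta>, 1)"] h_eq
  by (simp add: simple_aff_def aff_roots_def uminus_root highest_in_roots)

text \<open>Reflecting in \<alpha> lowers \<open>h * val \<beta>\<close>, which is at least 1, by
  the pairing c of the gradients. If c \<le> 1 the result is nonnegative. Otherwise the gradients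
  agree and c = 2, but then \<beta> is \<alpha> plus a positive multiple of \<delta>, with value at
  least 1 + h.\<close>

lemma simple_refl_pos:
  assumes \<alpha>: "\<alpha> \<in> simple_aff" and \<beta>: "\<beta> \<in> aff_roots" "val \<beta> > 0" and ne: "\<beta> \<noteq> \<alpha>"
  shows "val (aff_refl_root \<alpha> \<beta>) > 0"
proof -
  let ?c = "fst \<beta> \<bullet> fst \<alpha>"
  have roots: "fst \<alpha> \<in> \<Phi>" "fst \<beta> \<in> \<Phi>" and snds: "snd \<alpha> \<in> \<int>" "snd \<beta> \<in> \<int>"
    using \<alpha> \<beta> by (auto simp: simple_aff_def aff_roots_def)
  have eq: "h * val (aff_refl_root \<alpha> \<beta>) = h * val \<beta> - ?c"
    using \<alpha> by (simp add: aff_eval_refl_root simple_aff_def algebra_simps)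
  consider "?c \<le> 0" | "?c = 1" | "fst \<beta> = fst \<alpha>"
    using inner_roots_pos_cases[OF roots(2,1)] by fastforce
  then have "h * val (aff_refl_root \<alpha> \<beta>) \<ge> 0"
  proof cases
    case 3
    obtain m n :: int where mn: "snd \<alpha> = of_int m" "snd \<beta> = of_int n"
      using snds by (auto elim!: Ints_cases)
    \<comment> \<open>Affine roots with equal gradient differ by an integer multiple n - m of
      \<delta>, which contributes h (n - m). A negative multiple would make \<beta> negative at
      \<open>x0\<close>.\<close>
    have "h * val \<beta> = 1 + h * (snd \<beta> - snd \<alpha>)"
      using \<alpha> 3 by (simp add: simple_aff_def h_times_val algebra_simps)
    also have "\<dots> = 1 + h * of_int (n - m)" using mn by simp
    finally have hv: "h * val \<beta> = 1 + h * of_int (n - m)" .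
    have "n \<noteq> m" using ne 3 mn by (auto simp: prod_eq_iff)
    moreover have "\<not> n < m"
    proof
      assume "n < m"
      then have "real_of_int (n - m) \<le> -1" by linarith
      then have "h * of_int (n - m) \<le> h * -1" using h_ge_2 by (intro mult_left_mono) auto
      then show False using hv h_ge_2 h_val_ge_1[OF \<beta>] by simp
    qed
    ultimately have "real_of_int (n - m) \<ge> 1" by linarith
    then have "h * of_int (n - m) \<ge> h * 1" using h_ge_2 by (intro mult_left_mono) auto
    moreover have "?c = 2" using 3 inner_root_self[OF roots(1)] by simp
    ultimately show ?thesis using eq hv h_ge_2 by linarith
  qed (use eq h_val_ge_1[OF \<beta>] in auto)
  \<comment> \<open>Nonnegativity suffices, since no affine root vanishes at
    \<open>x0\<close>.\<close>
  then have "val (aff_refl_root \<alpha> \<beta>) \<ge> 0"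
    using h_ge_2 by (simp add: zero_le_mult_iff)
  then show ?thesis
    using val_nonzero[OF aff_refl_root_in[OF simple_aff_root[OF \<alpha>] \<beta>(1)]] by simp
qed

section \<open>Generation by simple affine reflections\<close>

text \<open>If \<beta> paired nonpositively with all simple roots and with -\<theta>, then \<theta>
  + \<beta>, whose coefficients are nonnegative since -\<beta> is below \<theta>, would satisfy
  (\<theta> + \<beta>) \<bullet> \<beta> \<le> 0. But \<theta> \<bullet> \<beta> \<ge> 0 and \<beta>
  \<bullet> \<beta> = 2.\<close>

lemma exists_descent:
  assumes "\<beta> \<in> \<Phi>"
  shows "\<exists>\<alpha>\<in>simple_aff. \<beta> \<bullet> fst \<alpha> > 0"
proof (rule ccontr)
  assume contra: "\<not> ?thesis"
  then have nonpos: "\<alpha> \<bullet> \<beta> \<le> 0" if "\<alpha> \<in> \<Delta>" for \<alpha>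
    using simple_in_simple_aff[OF that] by (force simp: inner_commute)
  have "\<theta> \<bullet> \<beta> \<ge> 0" using contra lowest_in_simple_aff by (force simp: inner_commute)
  then have "0 < (\<theta> + \<beta>) \<bullet> \<beta>"
    using inner_root_self[OF assms] by (simp add: inner_add_left)
  also have "(\<theta> + \<beta>) \<bullet> \<beta> \<le> 0"
    unfolding inner_expand[of "\<theta> + \<beta>"]
  proof (intro sum_nonpos mult_nonneg_nonpos nonpos)
    show "0 \<le> cf (\<theta> + \<beta>) \<alpha>" if "\<alpha> \<in> \<Delta>" for \<alpha>
      using highest_root(2)[OF uminus_root[OF assms] that] by (simp add: cf_add cf_uminus)
  qed
  finally show False by simp
qed

text \<open>Induction on \<open>h * val \<beta>\<close>, the height of the affine root. A simple
  \<alpha> with positive pairing lowers it, and the reflection in \<beta> is the reflection in the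
  lower root conjugated by that in \<alpha>.\<close>

lemma aff_refl_simple_word:
  assumes "\<beta> \<in> aff_roots" "val \<beta> > 0"
  shows "\<exists>ws. set ws \<subseteq> simple_aff \<and> refl_word ws = aff_refl \<beta>"
  using assms
proof (induction "nat \<lfloor>h * val \<beta>\<rfloor>" arbitrary: \<beta> rule: less_induct)
  case less
  show ?case
  proof (cases "\<beta> \<in> simple_aff")
    case True
    then show ?thesis by (intro exI[of _ "[\<beta>]"]) auto
  next
    case False
    have \<beta>\<Phi>: "fst \<beta> \<in> \<Phi>" using less.prems by (auto simp: aff_roots_def)
    then obtain \<alpha> where \<alpha>: "\<alpha> \<in> simple_aff" "fst \<beta> \<bullet> fst \<alpha> > 0"
      using exists_descent by blast
    have \<alpha>R: "\<alpha> \<in> aff_roots" using \<alpha> simple_aff_root by auto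
    have c: "fst \<beta> \<bullet> fst \<alpha> \<ge> 1"
      using inner_roots_pos_cases[OF \<beta>\<Phi> _ \<alpha>(2)] inner_root_self[OF \<beta>\<Phi>] \<alpha>R
      by (auto simp: aff_roots_def)
    let ?\<gamma> = "aff_refl_root \<alpha> \<beta>"
    have \<gamma>: "?\<gamma> \<in> aff_roots" "val ?\<gamma> > 0"
      using aff_refl_root_in[OF \<alpha>R less.prems(1)] simple_refl_pos[OF \<alpha>(1) less.prems] False \<alpha>(1)
      by auto
    have "h * val ?\<gamma> = h * val \<beta> - fst \<beta> \<bullet> fst \<alpha>"
      using \<alpha>(1) by (simp add: aff_eval_refl_root simple_aff_def algebra_simps)
    \<comment> \<open>The height drops by at least 1 and remains at least 1, so truncation by
      \<open>nat\<close> does not spoil the strict decrease.\<close>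
    then have "nat \<lfloor>h * val ?\<gamma>\<rfloor> < nat \<lfloor>h * val \<beta>\<rfloor>"
      using c h_val_ge_1[OF \<gamma>] by linarith
    from less.hyps[OF this \<gamma>] obtain ws where ws: "set ws \<subseteq> simple_aff" "refl_word ws = aff_refl ?\<gamma>"
      by auto
    have "refl_word (\<alpha> # ws @ [\<alpha>]) x = aff_refl \<beta> x" for x
      using ws(2) aff_refl_conj[OF \<alpha>R, of \<beta> "aff_refl \<alpha> x"] aff_refl_involution[OF \<alpha>R]
        aff_refl_conj[OF \<alpha>R, of \<beta> x]
      by (simp add: refl_word_append) metis
    then show ?thesis using ws \<alpha> by (intro exI[of _ "\<alpha> # ws @ [\<alpha>]"]) auto
  qed
qed

lemma refl_word_simple_word:
  assumes "set ws \<subseteq> aff_roots"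
  shows "\<exists>vs. set vs \<subseteq> simple_aff \<and> refl_word vs = refl_word ws"
  using assms
proof (induction ws)
  case Nil
  then show ?case by (intro exI[of _ "[]"]) auto
next
  case (Cons \<beta> ws)
  then obtain vs where vs: "set vs \<subseteq> simple_aff" "refl_word vs = refl_word ws" by auto
  have "val \<beta> > 0 \<or> val (- \<beta>) > 0"
    using val_nonzero[of \<beta>] Cons.prems by (auto simp: aff_eval_uminus)
  then obtain us where us: "set us \<subseteq> simple_aff" "refl_word us = aff_refl \<beta>"
    using aff_refl_simple_word[of \<beta>] aff_refl_simple_word[of "- \<beta>"] Cons.prems uminus_aff_root[of \<beta>]
    by (auto simp: aff_refl_uminus)
  have "refl_word (us @ vs) = refl_word (\<beta> # ws)"
    using us vs by (simp add: fun_eq_iff refl_word_append)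
  then show ?case using us vs by (intro exI[of _ "us @ vs"]) auto
qed

section \<open>Exchange condition and trivial stabilizer of \<open>x0\<close>\<close>

text \<open>The letters act one after another on the positive root \<alpha> and end at a negative
  root, so some letter changes the sign. A simple reflection makes only its own root negative, so
  the root at that moment is the letter itself, which can be deleted.\<close>

lemma exchange:
  assumes "set ws \<subseteq> simple_aff" "\<alpha> \<in> simple_aff" "val (word_root ws \<alpha>) < 0"
  shows "\<exists>vs. set vs \<subseteq> simple_aff \<and> length vs + 1 = length ws \<and>
    (\<forall>x. refl_word ws (aff_refl \<alpha> x) = refl_word vs x)"
  using assms
proof (induction ws)
  case Nil
  then show ?case using simple_aff_pos[of \<alpha>] by simp
next
  case (Cons \<beta> ws)
  have ws: "set ws \<subseteq> aff_roots" "\<beta> \<in> aff_roots" using Cons.prems simple_aff_root by auto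
  have root: "word_root ws \<alpha> \<in> aff_roots"
    using word_root_in[OF ws(1)] Cons.prems(2) simple_aff_root by auto
  show ?case
  proof (cases "val (word_root ws \<alpha>) < 0")
    case True
    then obtain vs where "set vs \<subseteq> simple_aff" "length vs + 1 = length ws"
      "\<forall>x. refl_word ws (aff_refl \<alpha> x) = refl_word vs x"
      using Cons by auto
    then show ?thesis using Cons.prems by (intro exI[of _ "\<beta> # vs"]) auto
  next
    case False
    then have "val (word_root ws \<alpha>) > 0" using val_nonzero[OF root] by simp
    then have "word_root ws \<alpha> = \<beta>"
      using simple_refl_pos[of \<beta>, OF _ root] Cons.prems by force
    \<comment> \<open>Moving the reflection in \<alpha> to the left past \<open>ws\<close> turns it
      into the reflection in \<beta>, which cancels the leading letter.\<close>
    then have "refl_word (\<beta> # ws) (aff_refl \<alpha> x) = refl_word ws x" for x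
      using refl_word_conj[OF ws(1), of \<alpha> x] by (simp add: aff_refl_involution[OF ws(2)])
    then show ?thesis using Cons.prems by (intro exI[of _ ws]) auto
  qed
qed

text \<open>If a word ending in \<alpha> fixes \<open>x0\<close>, the root to which its remaining
  letters send \<alpha> has value - \<open>val \<alpha>\<close> at \<open>x0\<close>. Exchange then
  gives a word for the same map with two letters fewer.\<close>

lemma refl_word_fixing_x0:
  assumes "set ws \<subseteq> simple_aff" "refl_word ws x0 = x0"
  shows "refl_word ws = id"
  using assms
proof (induction "length ws" arbitrary: ws rule: less_induct)
  case less
  show ?case
  proof (cases ws rule: rev_cases)
    case (snoc us \<alpha>)
    have us: "set us \<subseteq> simple_aff" and \<alpha>: "\<alpha> \<in> simple_aff" using less.prems snoc by auto
    have usR: "set us \<subseteq> aff_roots" and \<alpha>R: "\<alpha> \<in> aff_roots"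
      using us \<alpha> simple_aff_root by auto
    have "refl_word us (aff_refl \<alpha> x0) = x0"
      using less.prems(2) snoc by (simp add: refl_word_append)
    then have "val (word_root us \<alpha>) = aff_eval \<alpha> (aff_refl \<alpha> x0)"
      using aff_eval_word[OF usR, of \<alpha> "aff_refl \<alpha> x0"] by simp
    then have "val (word_root us \<alpha>) < 0"
      using simple_aff_pos[OF \<alpha>] by (simp add: aff_eval_refl[OF \<alpha>R])
    from exchange[OF us \<alpha> this] obtain vs where vs: "set vs \<subseteq> simple_aff" "length vs + 1 = length us"
      "\<forall>x. refl_word us (aff_refl \<alpha> x) = refl_word vs x" by auto
    then have "refl_word ws = refl_word vs" using snoc by (auto simp: refl_word_append)
    then show ?thesis using less.hyps[of vs] less.prems vs snoc by auto
  qed auto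
qed

section \<open>Moving a regular point to \<open>x0\<close>\<close>

text \<open>Reflecting \<open>z\<close> in a wall separating it from \<open>x0\<close> brings it closer to \<open>x0\<close>. Since both
  values of the affine root are multiples of \<open>1/h\<close>, the squared distance drops by at least
  \<open>2/h\<^sup>2\<close>, so the process ends in the fundamental alcove. There all simple affine roots
  are at least \<open>1/h\<close>, and their weighted sum is 1, so all are equal to \<open>1/h\<close>.\<close>

lemma refl_word_to_x0:
  assumes "\<And>\<alpha>. \<alpha> \<in> \<Phi> \<Longrightarrow> h * (\<alpha> \<bullet> z) \<in> \<int>" "\<And>\<beta>. \<beta> \<in> aff_roots \<Longrightarrow> aff_eval \<beta> z \<noteq> 0"
  shows "\<exists>ws. set ws \<subseteq> aff_roots \<and> refl_word ws z = x0"
  using assms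
proof (induction "nat \<lfloor>h\<^sup>2 * ((z - x0) \<bullet> (z - x0))\<rfloor>" arbitrary: z rule: less_induct)
  case less
  have int: "h * aff_eval \<beta> z \<in> \<int>" if "\<beta> \<in> aff_roots" for \<beta>
    using that less.prems(1)[of "fst \<beta>"] by (auto simp: aff_eval_def aff_roots_def distrib_left)
  have ge: "h * aff_eval \<beta> z \<ge> 1" if \<beta>: "\<beta> \<in> aff_roots" "aff_eval \<beta> z > 0" for \<beta>
  proof -
    obtain n :: int where "h * aff_eval \<beta> z = of_int n"
      using int[OF \<beta>(1)] by (auto elim: Ints_cases)
    moreover have "h * aff_eval \<beta> z > 0" using \<beta> h_ge_2 by simp
    ultimately show ?thesis by simp
  qed
  show ?case
  proof (cases "\<exists>\<beta>\<in>aff_roots. val \<beta> > 0 \<and> aff_eval \<beta> z < 0")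
    case True
    then obtain \<beta> where \<beta>: "\<beta> \<in> aff_roots" "val \<beta> > 0" "aff_eval \<beta> z < 0" by blast
    let ?z = "aff_refl \<beta> z" and ?e = "aff_eval \<beta> z"
    have "(?z - x0) \<bullet> (?z - x0) = (z - x0) \<bullet> (z - x0) - 2 * ?e * (fst \<beta> \<bullet> z - fst \<beta> \<bullet> x0) + ?e * ?e * 2"
      using aff_root_self[OF \<beta>(1)]
      by (simp add: aff_refl_def inner_diff_left inner_diff_right inner_commute algebra_simps)
    also have "\<dots> = (z - x0) \<bullet> (z - x0) + 2 * ?e * val \<beta>"
      by (simp add: aff_eval_def algebra_simps)
    finally have dist: "(?z - x0) \<bullet> (?z - x0) = (z - x0) \<bullet> (z - x0) + 2 * ?e * val \<beta>" .
    have "h\<^sup>2 * ((?z - x0) \<bullet> (?z - x0)) =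
        h\<^sup>2 * ((z - x0) \<bullet> (z - x0)) - 2 * ((h * aff_eval (- \<beta>) z) * (h * val \<beta>))"
      unfolding dist by (simp add: distrib_left power2_eq_square aff_eval_uminus)
    \<comment> \<open>Both -\<beta> at \<open>z\<close> and \<beta> at \<open>x0\<close> have
      positive values in (1/h)\<int>.\<close>
    moreover have "(h * aff_eval (- \<beta>) z) * (h * val \<beta>) \<ge> 1 * 1"
      using ge[OF uminus_aff_root[OF \<beta>(1)]] \<beta>(3) h_val_ge_1[OF \<beta>(1,2)]
      by (intro mult_mono) (auto simp: aff_eval_uminus)
    moreover have "h\<^sup>2 * ((?z - x0) \<bullet> (?z - x0)) \<ge> 0" by simp
    ultimately have dec: "nat \<lfloor>h\<^sup>2 * ((?z - x0) \<bullet> (?z - x0))\<rfloor> < nat \<lfloor>h\<^sup>2 * ((z - x0) \<bullet> (z - x0))\<rfloor>"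
      by linarith
    have "h * (\<alpha> \<bullet> ?z) \<in> \<int>" if "\<alpha> \<in> \<Phi>" for \<alpha>
    proof -
      have "h * (\<alpha> \<bullet> ?z) = h * (\<alpha> \<bullet> z) - (h * ?e) * (\<alpha> \<bullet> fst \<beta>)"
        by (simp add: aff_refl_def inner_diff_right algebra_simps)
      then show ?thesis
        using less.prems(1)[OF that] int[OF \<beta>(1)] inner_roots_Ints[OF that, of "fst \<beta>"] \<beta>(1)
        by (auto simp: aff_roots_def)
    qed
    moreover have "aff_eval \<gamma> ?z \<noteq> 0" if "\<gamma> \<in> aff_roots" for \<gamma>
      using less.prems(2)[OF aff_refl_root_in[OF \<beta>(1) that]] by (simp add: aff_eval_refl_swap[OF \<beta>(1)])
    ultimately obtain ws where "set ws \<subseteq> aff_roots" "refl_word ws ?z = x0"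
      using less.hyps[OF dec] by blast
    then show ?thesis using \<beta>(1) by (intro exI[of _ "ws @ [\<beta>]"]) (auto simp: refl_word_append)
  next
    case False
    have alcove: "h * aff_eval \<beta> z \<ge> 1" if "\<beta> \<in> simple_aff" for \<beta>
      using ge[OF simple_aff_root[OF that]] False less.prems(2)[OF simple_aff_root[OF that]]
        simple_aff_root[OF that] simple_aff_pos[OF that] by force
    have ge_simple: "h * (\<alpha> \<bullet> z) \<ge> 1" if "\<alpha> \<in> \<Delta>" for \<alpha>
      using alcove[OF simple_in_simple_aff[OF that]] by (simp add: aff_eval_def)
    have summand: "cf \<theta> \<alpha> * (h * (\<alpha> \<bullet> z) - 1) \<ge> 0" if "\<alpha> \<in> \<Delta>" for \<alpha>
      using ge_simple[OF that] dominant_full_support[OF highest_root(1) that] by simp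
    \<comment> \<open>The coefficients of \<theta> serve as weights. The simple affine root
      -\<theta> + \<delta> bounds h (\<theta> \<bullet> z) by h - 1, which is the height of
      \<theta>, so the nonnegative terms have sum at most 0.\<close>
    have "(\<Sum>\<alpha>\<in>\<Delta>. cf \<theta> \<alpha> * (h * (\<alpha> \<bullet> z) - 1)) = h * (\<theta> \<bullet> z) - \<theta> \<bullet> rho_check \<Delta>"
      by (simp add: inner_expand[of \<theta> z] inner_rho sum_subtractf sum_distrib_left algebra_simps)
    also have "\<dots> \<le> 0"
      using alcove[OF lowest_in_simple_aff] h_eq by (simp add: aff_eval_def algebra_simps)
    finally have "(\<Sum>\<alpha>\<in>\<Delta>. cf \<theta> \<alpha> * (h * (\<alpha> \<bullet> z) - 1)) = 0"
      using sum_nonneg[of \<Delta> "\<lambda>\<alpha>. cf \<theta> \<alpha> * (h * (\<alpha> \<bullet> z) - 1)"] summand by force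
    then have zero: "\<forall>\<alpha>\<in>\<Delta>. cf \<theta> \<alpha> * (h * (\<alpha> \<bullet> z) - 1) = 0"
      using summand by (subst (asm) sum_nonneg_eq_0_iff[OF finite_simple]) auto
    have "\<alpha> \<bullet> z = \<alpha> \<bullet> x0" if "\<alpha> \<in> \<Delta>" for \<alpha>
    proof -
      have "h * (\<alpha> \<bullet> z) = h * (\<alpha> \<bullet> x0)"
        using zero that dominant_full_support[OF highest_root(1) that] inner_rho_simple[OF that]
        by (fastforce simp: h_times_inner_x0)
      then show ?thesis using h_ge_2 by simp
    qed
    then have "z = x0" by (rule eq_if_inner_simple_eq)
    then show ?thesis by (intro exI[of _ "[]"]) auto
  qed
qed

section \<open>Affine Weyl group elements as words of reflections\<close>

lemma weyl_image_roots: "w \<in> weyl_group \<Phi> \<Longrightarrow> w ` \<Phi> = \<Phi>"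
proof (induction rule: weyl_group.induct)
  case (refl \<alpha> w)
  then show ?case
    using crystallographic unfolding image_comp[symmetric] crystallographic_root_system_def by simp
qed simp

lemma coroot_lattice_0: "0 \<in> coroot_lattice \<Phi>"
  unfolding coroot_lattice_def by (rule range_eqI[of _ _ "\<lambda>_. 0"]) simp

lemma coroot_lattice_add:
  assumes "\<mu> \<in> coroot_lattice \<Phi>" "\<nu> \<in> coroot_lattice \<Phi>"
  shows "\<mu> + \<nu> \<in> coroot_lattice \<Phi>"
proof -
  obtain c d :: "'a \<Rightarrow> int" where "\<mu> = (\<Sum>\<alpha>\<in>\<Phi>. of_int (c \<alpha>) *\<^sub>R coroot \<alpha>)"
    "\<nu> = (\<Sum>\<alpha>\<in>\<Phi>. of_int (d \<alpha>) *\<^sub>R coroot \<alpha>)"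
    using assms by (auto simp: coroot_lattice_def)
  then have "\<mu> + \<nu> = (\<Sum>\<alpha>\<in>\<Phi>. of_int (c \<alpha> + d \<alpha>) *\<^sub>R coroot \<alpha>)"
    by (simp add: sum.distrib scaleR_add_left)
  then show ?thesis unfolding coroot_lattice_def by (rule range_eqI[of _ _ "\<lambda>\<alpha>. c \<alpha> + d \<alpha>"])
qed

lemma multiple_in_coroot_lattice:
  assumes "\<alpha> \<in> \<Phi>"
  shows "of_int n *\<^sub>R \<alpha> \<in> coroot_lattice \<Phi>"
  unfolding coroot_lattice_def
proof (rule range_eqI[of _ _ "\<lambda>\<beta>. if \<beta> = \<alpha> then n else 0"])
  have "(\<Sum>\<beta>\<in>\<Phi>. of_int (if \<beta> = \<alpha> then n else 0) *\<^sub>R coroot \<beta>) =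
      (\<Sum>\<beta>\<in>\<Phi>. if \<beta> = \<alpha> then of_int n *\<^sub>R \<alpha> else 0)"
    by (intro sum.cong) (auto simp: coroot_root)
  then show "of_int n *\<^sub>R \<alpha> = (\<Sum>\<beta>\<in>\<Phi>. of_int (if \<beta> = \<alpha> then n else 0) *\<^sub>R coroot \<beta>)"
    using finite_roots assms by simp
qed

text \<open>For \<beta> = (\<alpha>, n), the reflection sends y to the linear reflection of y + n
  \<alpha>. Writing \<alpha> = w \<gamma> moves this shift through w into the translation
  part.\<close>

lemma refl_word_affine_elem:
  assumes "set ws \<subseteq> aff_roots"
  shows "\<exists>u\<in>affine_weyl_group \<Phi>. refl_word ws = aff_act u"
  using assms
proof (induction ws)
  case Nil
  have "(id, 0) \<in> affine_weyl_group \<Phi>"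
    by (simp add: affine_weyl_group_def coroot_lattice_0 weyl_group.id)
  then show ?case by (intro bexI[of _ "(id, 0)"]) auto
next
  case (Cons \<beta> ws)
  then obtain w \<mu> where w: "w \<in> weyl_group \<Phi>" and \<mu>: "\<mu> \<in> coroot_lattice \<Phi>"
    and ws: "refl_word ws = aff_act (w, \<mu>)"
    by (auto simp: affine_weyl_group_def)
  obtain \<alpha> n where \<beta>: "\<beta> = (\<alpha>, real_of_int n)" and \<alpha>: "\<alpha> \<in> \<Phi>"
    using Cons.prems by (auto simp: aff_roots_def elim!: Ints_cases)
  obtain \<gamma> where \<gamma>: "\<gamma> \<in> \<Phi>" "\<alpha> = w \<gamma>" using weyl_image_roots[OF w] \<alpha> by blast
  let ?u = "(root_reflection \<alpha> \<circ> w, \<mu> + of_int n *\<^sub>R \<gamma>)"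
  have "?u \<in> affine_weyl_group \<Phi>"
    using coroot_lattice_add[OF \<mu> multiple_in_coroot_lattice[OF \<gamma>(1)]] weyl_group.refl[OF \<alpha> w]
    by (simp add: affine_weyl_group_def)
  moreover have "refl_word (\<beta> # ws) x = aff_act ?u x" for x
  proof -
    have lin: "linear w" using weyl_group_isometry[OF w] by simp
    have "w (x + (\<mu> + of_int n *\<^sub>R \<gamma>)) = w (x + \<mu>) + of_int n *\<^sub>R \<alpha>"
      unfolding add.assoc[symmetric] by (simp add: linear_add[OF lin] linear_scale[OF lin] \<gamma>)
    then show ?thesis
      using inner_root_self[OF \<alpha>] inner_commute[of \<alpha> "w (x + \<mu>)"]
      by (simp add: ws \<beta> aff_refl_def aff_eval_def root_reflection_root[OF \<alpha>] inner_add_left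
          algebra_simps flip: scaleR_2 scaleR_add_left)
  qed
  ultimately show ?case by (intro bexI[of _ ?u]) auto
qed

lemma weyl_refl_word:
  "w \<in> weyl_group \<Phi> \<Longrightarrow> \<exists>ws. set ws \<subseteq> aff_roots \<and> refl_word ws = w"
proof (induction rule: weyl_group.induct)
  case id
  then show ?case by (intro exI[of _ "[]"]) auto
next
  case (refl \<alpha> w)
  then obtain ws where "set ws \<subseteq> aff_roots" "refl_word ws = w" by auto
  moreover have "aff_refl (\<alpha>, 0) x = root_reflection \<alpha> x" for x
    by (simp add: aff_refl_def aff_eval_def root_reflection_root refl inner_commute)
  ultimately show ?case using refl
    by (intro exI[of _ "(\<alpha>, 0) # ws"]) (auto simp: aff_roots_def)
qed

text \<open>Two reflections in parallel walls compose to a translation, here by a multiple of one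
  coroot; the summands of \<mu> are collected one root at a time.\<close>

lemma translation_refl_word:
  assumes "\<mu> \<in> coroot_lattice \<Phi>"
  shows "\<exists>ws. set ws \<subseteq> aff_roots \<and> refl_word ws = (\<lambda>x. x + \<mu>)"
proof -
  obtain c :: "'a \<Rightarrow> int" where c: "\<mu> = (\<Sum>\<alpha>\<in>\<Phi>. of_int (c \<alpha>) *\<^sub>R coroot \<alpha>)"
    using assms by (auto simp: coroot_lattice_def)
  have "\<exists>ws. set ws \<subseteq> aff_roots \<and>
      refl_word ws = (\<lambda>x. x + (\<Sum>\<alpha>\<in>F. of_int (c \<alpha>) *\<^sub>R coroot \<alpha>))" if "F \<subseteq> \<Phi>" for F
    using finite_subset[OF that finite_roots] that
  proof (induction F)
    case empty
    then show ?case by (intro exI[of _ "[]"]) auto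
  next
    case (insert \<alpha> F)
    then obtain ws where ws: "set ws \<subseteq> aff_roots"
      "refl_word ws = (\<lambda>x. x + (\<Sum>\<alpha>\<in>F. of_int (c \<alpha>) *\<^sub>R coroot \<alpha>))" by auto
    have \<alpha>: "\<alpha> \<in> \<Phi>" using insert by auto
    have "aff_refl (\<alpha>, - of_int (c \<alpha>)) (aff_refl (\<alpha>, 0) x) = x + of_int (c \<alpha>) *\<^sub>R coroot \<alpha>" for x
      using inner_root_self[OF \<alpha>]
      by (simp add: aff_refl_def aff_eval_def coroot_root[OF \<alpha>] inner_diff_right algebra_simps)
    then show ?case using ws \<alpha> insert.hyps
      by (intro exI[of _ "(\<alpha>, - of_int (c \<alpha>)) # (\<alpha>, 0) # ws"])
        (auto simp: aff_roots_def algebra_simps)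
  qed
  then show ?thesis using c by blast
qed

lemma affine_elem_refl_word:
  assumes "u \<in> affine_weyl_group \<Phi>"
  shows "\<exists>ws. set ws \<subseteq> aff_roots \<and> refl_word ws = aff_act u"
proof -
  obtain w \<mu> where u: "u = (w, \<mu>)" "w \<in> weyl_group \<Phi>" "\<mu> \<in> coroot_lattice \<Phi>"
    using assms by (auto simp: affine_weyl_group_def)
  obtain ws vs where "set ws \<subseteq> aff_roots" "refl_word ws = w"
    "set vs \<subseteq> aff_roots" "refl_word vs = (\<lambda>x. x + \<mu>)"
    using weyl_refl_word[OF u(2)] translation_refl_word[OF u(3)] by blast
  then show ?thesis
    by (intro exI[of _ "ws @ vs"]) (auto simp: refl_word_append u(1))
qed

text \<open>The value at 0 determines w \<mu>, hence the linear part w, and injectivity of w then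
  determines \<mu>.\<close>

lemma aff_act_inj:
  assumes "u \<in> affine_weyl_group \<Phi>" "v \<in> affine_weyl_group \<Phi>" "aff_act u = aff_act v"
  shows "u = v"
proof -
  obtain w \<mu> w' \<mu>' where u: "u = (w, \<mu>)" "w \<in> weyl_group \<Phi>" and v: "v = (w', \<mu>')" "w' \<in> weyl_group \<Phi>"
    using assms by (auto simp: affine_weyl_group_def)
  have lin: "linear w" "linear w'" and inj: "inj w"
    using weyl_group_isometry[OF u(2)] weyl_group_isometry[OF v(2)] by (auto simp: bij_is_inj)
  have eq: "w x + w \<mu> = w' x + w' \<mu>'" for x
    using fun_cong[OF assms(3), of x] u(1) v(1) lin by (simp add: linear_add)
  have "w \<mu> = w' \<mu>'" using eq[of 0] lin by (simp add: linear_0)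
  then have "w = w'" using eq by (auto simp: fun_eq_iff)
  then show ?thesis using \<open>w \<mu> = w' \<mu>'\<close> inj u(1) v(1) by (auto dest: injD)
qed

section \<open>Uniqueness and existence of the element sending \<open>x0\<close> to b
  \<open>x0\<close>\<close>

text \<open>A word for u followed by the reversed word for v fixes \<open>x0\<close>. Rewritten in
  simple affine reflections, it is the identity.\<close>

lemma aff_act_x0_inj:
  assumes "u \<in> affine_weyl_group \<Phi>" "v \<in> affine_weyl_group \<Phi>" "aff_act u x0 = aff_act v x0"
  shows "u = v"
proof -
  obtain us vs where us: "set us \<subseteq> aff_roots" "refl_word us = aff_act u"
    and vs: "set vs \<subseteq> aff_roots" "refl_word vs = aff_act v"
    using assms(1,2) affine_elem_refl_word by meson
  have "refl_word (rev vs @ us) x0 = x0"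
    using assms(3) us(2) vs(2) refl_word_rev[OF vs(1), of x0] by (simp add: refl_word_append)
  moreover obtain ws where "set ws \<subseteq> simple_aff" "refl_word ws = refl_word (rev vs @ us)"
    using refl_word_simple_word[of "rev vs @ us"] us(1) vs(1) by auto
  ultimately have "refl_word (rev vs @ us) = id"
    using refl_word_fixing_x0[of ws] by simp
  then have "refl_word (rev vs) (refl_word us x) = x" for x
    by (metis refl_word_append id_apply)
  then have "refl_word us x = refl_word vs x" for x
    using refl_word_rev[of "rev vs" "refl_word us x"] vs(1) by simp
  then show ?thesis using aff_act_inj[OF assms(1,2)] us(2) vs(2) by auto
qed

lemma sends_rho_iff: "sends_rho \<Phi> \<Delta> b u \<longleftrightarrow> aff_act u x0 = of_int b *\<^sub>R x0"
  by (simp add: sends_rho_def x0_def)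

text \<open>A wall through b \<open>x0\<close> gives b ht(\<alpha>) = -h n. Coprimality makes h
  divide ht(\<alpha>), so \<alpha> \<bullet> x0 would be an integer.\<close>

lemma scaled_x0_regular:
  assumes "coprime b (coxeter_number \<Phi> \<Delta>)" "\<beta> \<in> aff_roots"
  shows "aff_eval \<beta> (of_int b *\<^sub>R x0) \<noteq> 0"
proof
  assume zero: "aff_eval \<beta> (of_int b *\<^sub>R x0) = 0"
  obtain \<alpha> n where \<beta>: "\<beta> = (\<alpha>, real_of_int n)" and \<alpha>: "\<alpha> \<in> \<Phi>"
    using assms(2) by (auto simp: aff_roots_def elim!: Ints_cases)
  have "h * (of_int b * (\<alpha> \<bullet> x0) + of_int n) = 0"
    using zero by (simp add: \<beta> aff_eval_def)
  then have "of_int b * (h * (\<alpha> \<bullet> x0)) + h * of_int n = 0" by (simp add: algebra_simps)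
  then have "real_of_int (b * ht \<Delta> \<alpha> + coxeter_number \<Phi> \<Delta> * n) = 0"
    by (simp add: h_times_inner_x0 ht_eq[OF \<alpha>])
  then have "b * ht \<Delta> \<alpha> = coxeter_number \<Phi> \<Delta> * (- n)" by linarith
  then have "coxeter_number \<Phi> \<Delta> dvd b * ht \<Delta> \<alpha>" by (metis dvd_triv_left)
  then have "coxeter_number \<Phi> \<Delta> dvd ht \<Delta> \<alpha>"
    using assms(1) by (simp add: coprime_commute coprime_dvd_mult_right_iff)
  then obtain k where "ht \<Delta> \<alpha> = coxeter_number \<Phi> \<Delta> * k" by blast
  then have "h * (\<alpha> \<bullet> x0) = h * of_int k"
    by (simp add: h_times_inner_x0 ht_eq[OF \<alpha>, symmetric])
  then have "\<alpha> \<bullet> x0 = of_int k" using h_ge_2 by simp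
  then show False using inner_x0_Ints[OF \<alpha>] by simp
qed

lemma exists_sends_rho:
  assumes "coprime b (coxeter_number \<Phi> \<Delta>)"
  shows "\<exists>u\<in>affine_weyl_group \<Phi>. sends_rho \<Phi> \<Delta> b u"
proof -
  let ?z = "of_int b *\<^sub>R x0"
  have "h * (\<alpha> \<bullet> ?z) \<in> \<int>" if "\<alpha> \<in> \<Phi>" for \<alpha>
  proof -
    have "h * (\<alpha> \<bullet> ?z) = of_int b * (h * (\<alpha> \<bullet> x0))" by simp
    also have "\<dots> = of_int (b * ht \<Delta> \<alpha>)" by (simp add: h_times_inner_x0 ht_eq[OF that])
    finally show ?thesis by (metis Ints_of_int)
  qed
  then obtain ws where ws: "set ws \<subseteq> aff_roots" "refl_word ws ?z = x0"
    using refl_word_to_x0[of ?z] scaled_x0_regular[OF assms] by blast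
  then have "refl_word (rev ws) x0 = ?z" using refl_word_rev[OF ws(1), of ?z] by simp
  moreover obtain u where "u \<in> affine_weyl_group \<Phi>" "refl_word (rev ws) = aff_act u"
    using refl_word_affine_elem[of "rev ws"] ws(1) by auto
  ultimately show ?thesis unfolding sends_rho_iff by metis
qed

section \<open>Inversion sets as sign conditions\<close>

text \<open>The value \<gamma> \<bullet> x0 lies in (0, 1) for positive \<gamma> and in (-1, 0) for
  negative \<gamma>. The sign of k therefore decides, and for k = 0 the sign of \<gamma>.\<close>

lemma pos_affine_roots_iff:
  "(\<gamma>, k) \<in> pos_affine_roots \<Phi> \<Delta> \<longleftrightarrow> \<gamma> \<in> \<Phi> \<and> val (\<gamma>, of_int k) > 0"
proof -
  have "(\<gamma>, k) \<in> pos_affine_roots \<Phi> \<Delta> \<longleftrightarrow>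
      \<gamma> \<in> pos_roots \<Phi> \<Delta> \<and> 0 \<le> k \<or> - \<gamma> \<in> pos_roots \<Phi> \<Delta> \<and> 0 < k"
    by (auto simp: pos_affine_roots_def)
  also have "\<dots> \<longleftrightarrow> \<gamma> \<in> \<Phi> \<and> \<gamma> \<bullet> x0 + of_int k > 0"
  proof -
    consider "\<gamma> \<in> pos_roots \<Phi> \<Delta>" | "- \<gamma> \<in> pos_roots \<Phi> \<Delta>" | "\<gamma> \<notin> \<Phi>" using pos_or_neg by blast
    then show ?thesis
    proof cases
      case 1
      then have "\<gamma> \<in> \<Phi>" "- \<gamma> \<notin> pos_roots \<Phi> \<Delta>" by (auto simp: pos_roots_iff)
      moreover have "0 \<le> k \<longleftrightarrow> \<gamma> \<bullet> x0 + of_int k > 0"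
        using inner_x0_bounds[OF 1] by linarith
      ultimately show ?thesis using 1 by simp
    next
      case 2
      then have "\<gamma> \<in> \<Phi>" "\<gamma> \<notin> pos_roots \<Phi> \<Delta>" by (auto simp: pos_roots_iff uminus_root_iff)
      moreover have "0 < - (\<gamma> \<bullet> x0)" "- (\<gamma> \<bullet> x0) < 1" using inner_x0_bounds[OF 2] by auto
      then have "0 < k \<longleftrightarrow> \<gamma> \<bullet> x0 + of_int k > 0" by linarith
      ultimately show ?thesis using 2 by simp
    next
      case 3
      then show ?thesis by (auto simp: pos_roots_iff uminus_root_iff)
    qed
  qed
  finally show ?thesis by (simp add: aff_eval_def)
qed

lemma inversion_set_iff:
  assumes "u \<in> affine_weyl_group \<Phi>"
  shows "(\<gamma>, k) \<in> inversion_set \<Phi> \<Delta> u \<longleftrightarrow>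
    \<gamma> \<in> \<Phi> \<and> val (\<gamma>, of_int k) > 0 \<and> aff_eval (\<gamma>, of_int k) (aff_act u x0) \<le> 0"
proof (cases "\<gamma> \<in> \<Phi>")
  case True
  obtain w \<mu> where u: "u = (w, \<mu>)" "w \<in> weyl_group \<Phi>" "\<mu> \<in> coroot_lattice \<Phi>"
    using assms by (auto simp: affine_weyl_group_def)
  note w = weyl_group_isometry[OF u(2)]
  obtain \<delta> where \<delta>: "\<delta> \<in> \<Phi>" "\<gamma> = w \<delta>" using weyl_image_roots[OF u(2)] True by blast
  obtain m :: int where m: "\<mu> \<bullet> \<delta> = of_int m"
    using coroot_lattice_integral[OF crystallographic u(3) \<delta>(1)] by (auto elim: Ints_cases)
  \<comment> \<open>The inverse carries the translation -w \<mu>, whose pairing with w \<delta> is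
    -m, hence k + m.\<close>
  have "aff_root_act (aff_inv u) (\<gamma>, k) = (\<delta>, k + m)"
    using w m by (simp add: u(1) \<delta>(2) bij_is_inj flip: of_int_minus)
  moreover have "aff_eval (\<gamma>, of_int k) (aff_act u x0) = val (\<delta>, of_int (k + m))"
    using w m by (simp add: u(1) \<delta>(2) aff_eval_def inner_add_right inner_commute[of \<delta> \<mu>])
  ultimately show ?thesis
    using True \<delta>(1) by (auto simp: inversion_set_def pos_affine_roots_iff)
qed (simp add: inversion_set_def pos_affine_roots_iff)

text \<open>A positive gradient is never inverted: k \<ge> 0 and b > 0 keep the value at b
  \<open>x0\<close> positive. For the gradient -\<alpha>, positivity at \<open>x0\<close> means k >
  0, and inversion means k \<le> b (\<alpha> \<bullet> x0), where regularity of b \<open>x0\<close>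
  excludes equality.\<close>

lemma inversion_set_sends_rho:
  assumes "b > 0" "coprime b (coxeter_number \<Phi> \<Delta>)"
    and u: "u \<in> affine_weyl_group \<Phi>" "sends_rho \<Phi> \<Delta> b u"
  shows "inversion_set \<Phi> \<Delta> u =
      {(- \<alpha>, k) | \<alpha> k. \<alpha> \<in> pos_roots \<Phi> \<Delta> \<and> 0 < k \<and>
        real_of_int k < of_int b / h * of_int (ht \<Delta> \<alpha>)}" (is "_ = ?R")
proof -
  have mem: "(\<gamma>, k) \<in> inversion_set \<Phi> \<Delta> u \<longleftrightarrow> (\<gamma>, k) \<in> ?R" for \<gamma> k
  proof -
    have inv: "(\<gamma>, k) \<in> inversion_set \<Phi> \<Delta> u \<longleftrightarrow>
        \<gamma> \<in> \<Phi> \<and> \<gamma> \<bullet> x0 + of_int k > 0 \<and> of_int b * (\<gamma> \<bullet> x0) + of_int k \<le> 0"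
      using inversion_set_iff[OF u(1)] u(2) by (simp add: sends_rho_iff aff_eval_def)
    have height: "of_int b / h * of_int (ht \<Delta> \<alpha>) = of_int b * (\<alpha> \<bullet> x0)" if "\<alpha> \<in> \<Phi>" for \<alpha>
      using h_times_inner_x0[of \<alpha>] h_ge_2 ht_eq[OF that] by (simp add: field_simps)
    have R: "(\<gamma>, k) \<in> ?R \<longleftrightarrow> - \<gamma> \<in> pos_roots \<Phi> \<Delta> \<and> 0 < k \<and> of_int k < of_int b * (- \<gamma> \<bullet> x0)"
    proof
      assume "(\<gamma>, k) \<in> ?R"
      then show "- \<gamma> \<in> pos_roots \<Phi> \<Delta> \<and> 0 < k \<and> of_int k < of_int b * (- \<gamma> \<bullet> x0)"
        using height by (auto simp: pos_roots_iff)
    next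
      assume "- \<gamma> \<in> pos_roots \<Phi> \<Delta> \<and> 0 < k \<and> of_int k < of_int b * (- \<gamma> \<bullet> x0)"
      then show "(\<gamma>, k) \<in> ?R"
        using height[of "- \<gamma>"] by (intro CollectI exI[of _ "- \<gamma>"] exI[of _ k]) (simp add: pos_roots_iff)
    qed
    consider "\<gamma> \<in> pos_roots \<Phi> \<Delta>" | "- \<gamma> \<in> pos_roots \<Phi> \<Delta>" | "\<gamma> \<notin> \<Phi>" using pos_or_neg by blast
    then show ?thesis
    proof cases
      case 1
      then have "- \<gamma> \<notin> pos_roots \<Phi> \<Delta>" by (auto simp: pos_roots_iff)
      moreover have "of_int b * (\<gamma> \<bullet> x0) > 0" using inner_x0_bounds[OF 1] assms(1) by simp
      moreover have "k \<ge> 0" if "\<gamma> \<bullet> x0 + of_int k > 0" using that inner_x0_bounds[OF 1] by linarith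
      ultimately show ?thesis unfolding inv R by force
    next
      case 2
      then have root: "\<gamma> \<in> \<Phi>" by (auto simp: pos_roots_iff uminus_root_iff)
      have "aff_eval (\<gamma>, of_int k) (of_int b *\<^sub>R x0) \<noteq> 0"
        using root by (intro scaled_x0_regular assms) (simp add: aff_roots_def)
      then have "of_int b * (\<gamma> \<bullet> x0) + of_int k \<noteq> 0" by (simp add: aff_eval_def)
      moreover have "0 < - (\<gamma> \<bullet> x0)" "- (\<gamma> \<bullet> x0) < 1" using inner_x0_bounds[OF 2] by auto
      then have "\<gamma> \<bullet> x0 + of_int k > 0 \<longleftrightarrow> 0 < k" by linarith
      ultimately show ?thesis unfolding inv R using 2 root by auto
    next
      case 3
      then show ?thesis unfolding inv R by (auto simp: pos_roots_iff uminus_root_iff)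
    qed
  qed
  show ?thesis unfolding set_eq_iff split_paired_All by (intro allI) (rule mem)
qed

end

theorem theorem6p12:
  fixes \<Phi> \<Delta> :: "'a::euclidean_space set" and b :: int
  assumes "crystallographic_root_system \<Phi>"
    and "irreducible_roots \<Phi>"
    and "simple_roots \<Phi> \<Delta>"
    and "simply_laced \<Phi>"
    and "b > 0"
    and "coprime b (coxeter_number \<Phi> \<Delta>)"
  shows "(\<exists>!u. u \<in> affine_weyl_group \<Phi> \<and> sends_rho \<Phi> \<Delta> b u) \<and>
    inversion_set \<Phi> \<Delta> (w_elem \<Phi> \<Delta> b) =
      {(- \<alpha>, k) | \<alpha> k. \<alpha> \<in> pos_roots \<Phi> \<Delta> \<and> 0 < k \<and>
        real_of_int k < of_int b / of_int (coxeter_number \<Phi> \<Delta>) * of_int (ht \<Delta> \<alpha>)}"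
proof -
  interpret simply_laced_system \<Phi> \<Delta>
    using assms by unfold_locales
  have unique: "\<exists>!u. u \<in> affine_weyl_group \<Phi> \<and> sends_rho \<Phi> \<Delta> b u"
    using exists_sends_rho[OF assms(6)] aff_act_x0_inj by (metis sends_rho_iff)
  then have "w_elem \<Phi> \<Delta> b \<in> affine_weyl_group \<Phi> \<and> sends_rho \<Phi> \<Delta> b (w_elem \<Phi> \<Delta> b)"
    unfolding w_elem_def by (rule theI')
  then show ?thesis
    using unique inversion_set_sends_rho[OF assms(5,6)] by blast
qed

end
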